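(* Let $q>0$ and let $I$ be a square-free monomial ideal minimally generated by $m_1,\ldots,m_q$. Then $I^2$ has the following divisibility relations. (1) $m_im_j\mid\operatorname{lcm}(m_j^2,m_im_a)$ where $i,j,a\in[q]$ are such that $i<j$ and $a\notin\{i,j\}$; (2) $m_im_j\mid\operatorname{lcm}(m_i^2,m_jm_b)$ where $i,j,b\in[q]$ are such that $i<j$ and $b\neq i$. If, for some $3\le s\le q$, $I$ satisfies the divisibility relation $m_1\mid\operatorname{lcm}(m_2,\ldots,m_s)$, then $I^2$ also satisfies the following divisibility relations for indices $j,u,t_2,\ldots,t_s\in[q]$: (3) $m_1m_j\mid\operatorname{lcm}(m_2m_{t_2},\ldots,m_sm_{t_s})$ where $t_k\in\{1,j,k\}$ for all $2\le k\le s$ and either (3a) $j=1$; or (3b) $j>s$ and $j\in\{t_2,\ldots,t_s\}$; (4) $m_1m_j\mid\operatorname{lcm}(m_2m_{t_2},\ldots,m_sm_{t_s},m_um_j)$ where either (4a) $j>s$, $u>s$, $j\neq u$ and $t_k\in\{1,k\}$ for all $2\le k\le s$; or (4b) $j=u>1$ and $t_k>1$ for all $2\le k\le s$. Moreover, if $\mathcal D$ is a set of divisibility relations and $m_i=\epsilon_{\mathcal D,i}$ for $1\le i\le q$ (so $I=\mathcal E_{q,\mathcal D}$), then: (i) When $\mathcal D=\emptyset$, the set of minimal divisibility relations on $\mathcal E_{q,\mathcal D}^2$ consists of the relations in (1) and (2). (ii) When $\mathcal D=\{(1,\{2,\ldots,s\})\}$ with $3\le s\le q$, the set of minimal divisibility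 relations on $\mathcal E_{q,\mathcal D}^2$ consists of the relations in (1), (2), (3), (4a), which are minimal, together with those relations in (4b) that are not extensions of another relation of the form (4b) or of a relation of the form (3b).
   Context: $[q]=\{1,\ldots,q\}$. Divisibility relations: for a set $U=\{u_i:i\in\Lambda\}$ of distinct monomials indexed by a finite set $\Lambda$, a divisibility relation on $U$ is a pair $(b,B)$ with $b\in\Lambda$, $\emptyset\neq B\subseteq\Lambda$ such that $u_b\mid\operatorname{lcm}(u_i:i\in B)$. It is trivial if $b\in B$. A relation $(c,C)$ is an extension of $(b,B)$ if $b=c$ and $B\subseteq C$. A divisibility relation on $U$ is minimal if it is non-trivial and is not an extension of any other divisibility relation on $U$. Divisibility relations on a monomial ideal are those on its set of minimal monomial generators. $\mathcal D$-extremal ideal: let $\mathcal D=\{(b_1,B_1),\ldots,(b_d,B_d)\}\subseteq[q]\times(2^{[q]}\smallsetminus\{\emptyset\})$ with $|B_l|\ge2$ for all $l$ ($\mathcal D=\emptyset$ if $d=0$). Over a field $\mathsf k$ let $S_{[q]}=\mathsf k[y_A:\emptyset\ne A\subseteq[q]]$, $Q(\mathcal D)=\{A\subseteq[q]:A\neq\emptyset,\text{ and for all }l\in\{1,\dots,d\},\ b_l\notin A\text{ or }A\cap B_l\neq\emptyset\}$, and for $i\in[q]$ put $\epsilon_{\mathcal D,i}=\prod_{A\in Q(\mathcal D),\,i\in A}y_A$. Then $\mathcal E_{q,\mathcal D}=(\epsilon_{\mathcal D,1},\ldots,\epsilon_{\mathcal D,q})$. It is known that $\mathcal E_{q,\mathcal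 D}$ is minimally generated by the $\epsilon_{\mathcal D,i}$, and $\mathcal E_{q,\mathcal D}^2$ is minimally generated by the $\binom{q+1}2$ distinct monomials $\epsilon_{\mathcal D,i}\epsilon_{\mathcal D,j}$, $1\le i\le j\le q$; relations on $\mathcal E_{q,\mathcal D}^2$ are indexed by the unordered pairs $\{i,j\}$ (with $i=j$ allowed), and the set $B$ of a relation is the set of indices of the products listed inside the lcm (repetitions being discarded). *)

theory Defs
  imports "HOL-Library.Poly_Mapping" "HOL-Library.Multiset" "HOL-Algebra.Ideal_Product"
begin

section \<open>Polynomial rings and monomials\<close>

text \<open>A polynomial is a finitely supported map from exponent vectors to coefficients, with the
  ring structure of \<^theory>\<open>HOL-Library.Poly_Mapping\<close>. The multivariate polynomial ring
  \<open>k[V]\<close> is packaged as a record so that ideals, generated ideals and products of ideals are those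
  of \<open>HOL-Algebra\<close>.\<close>

type_synonym ('v, 'k) mpol = "('v \<Rightarrow>\<^sub>0 nat) \<Rightarrow>\<^sub>0 'k"

definition poly_ring :: "'v set \<Rightarrow> ('v, 'k::field) mpol ring" where
  "poly_ring V =
     \<lparr>carrier = {p. \<forall>s \<in> Poly_Mapping.keys p. Poly_Mapping.keys s \<subseteq> V},
      mult = (*), one = 1, zero = 0, add = (+)\<rparr>"

definition mono_of :: "('v \<Rightarrow>\<^sub>0 nat) \<Rightarrow> ('v, 'k::field) mpol" where
  "mono_of s = Poly_Mapping.single s 1"

definition var :: "'v \<Rightarrow> ('v, 'k::field) mpol" where
  "var v = mono_of (Poly_Mapping.single v 1)"

definition monomials :: "'v set \<Rightarrow> ('v, 'k::field) mpol set" where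
  "monomials V = {mono_of s |s. Poly_Mapping.keys s \<subseteq> V}"

definition sqfree_monomials :: "'v set \<Rightarrow> ('v, 'k::field) mpol set" where
  "sqfree_monomials V =
     {mono_of s |s. Poly_Mapping.keys s \<subseteq> V \<and> (\<forall>v. Poly_Mapping.lookup s v \<le> 1)}"

text \<open>The exponent vector of the lcm of monomials is the pointwise maximum. Only meant for finite
  nonempty sets of monomials.\<close>

definition mono_lcm :: "('v, 'k::field) mpol set \<Rightarrow> ('v, 'k) mpol" where
  "mono_lcm M =
     mono_of (Poly_Mapping.Abs_poly_mapping
       (\<lambda>v. Max {Poly_Mapping.lookup s v |s. mono_of s \<in> M}))"

definition sqfree_monomial_ideal :: "'v set \<Rightarrow> ('v, 'k::field) mpol set \<Rightarrow> bool" where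
  "sqfree_monomial_ideal V I \<longleftrightarrow>
     (\<exists>M \<subseteq> sqfree_monomials V. I = genideal (poly_ring V) M)"

definition minimally_generated ::
    "'v set \<Rightarrow> ('v, 'k::field) mpol set \<Rightarrow> 'i set \<Rightarrow> ('i \<Rightarrow> ('v, 'k) mpol) \<Rightarrow> bool" where
  "minimally_generated V I \<Lambda> u \<longleftrightarrow>
     inj_on u \<Lambda> \<and> u ` \<Lambda> \<subseteq> monomials V \<and> I = genideal (poly_ring V) (u ` \<Lambda>) \<and>
     (\<forall>G. G \<subset> u ` \<Lambda> \<longrightarrow> I \<noteq> genideal (poly_ring V) G)"

section \<open>Divisibility relations\<close>

text \<open>The relations are those of the monomials \<open>u i\<close> indexed by \<open>i \<in> \<Lambda>\<close>. Distinctness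
  of these monomials is not part of the definition: the products of generators of an arbitrary
  square-free monomial ideal may coincide. Divisibility of monomials does not depend on the set of
  variables of the ambient polynomial ring.\<close>

definition div_rels :: "'i set \<Rightarrow> ('i \<Rightarrow> ('v, 'k::field) mpol) \<Rightarrow> ('i \<times> 'i set) set" where
  "div_rels \<Lambda> u =
     {(b, B). b \<in> \<Lambda> \<and> B \<noteq> {} \<and> B \<subseteq> \<Lambda> \<and> u b dvd mono_lcm (u ` B)}"

definition trivial_rel :: "'i \<times> 'i set \<Rightarrow> bool" where
  "trivial_rel r \<longleftrightarrow> fst r \<in> snd r"

definition extension_of :: "'i \<times> 'i set \<Rightarrow> 'i \<times> 'i set \<Rightarrow> bool" where
  "extension_of r' r \<longleftrightarrow> fst r = fst r' \<and> snd r \<subseteq> snd r'"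

definition min_div_rels :: "'i set \<Rightarrow> ('i \<Rightarrow> ('v, 'k::field) mpol) \<Rightarrow> ('i \<times> 'i set) set" where
  "min_div_rels \<Lambda> u =
     {r \<in> div_rels \<Lambda> u. \<not> trivial_rel r \<and>
        (\<forall>r' \<in> div_rels \<Lambda> u. r' \<noteq> r \<longrightarrow> \<not> extension_of r r')}"

section \<open>Products of two generators and their relations\<close>

text \<open>The unordered pair with entries \<open>i\<close> and \<open>j\<close>, where \<open>i = j\<close> is allowed, is the multiset
  \<open>{#i, j#}\<close>; it indexes the product of \<open>m i\<close> and \<open>m j\<close>.\<close>

definition pairs :: "nat \<Rightarrow> nat multiset set" where
  "pairs q = {{#i, j#} |i j. i \<in> {1..q} \<and> j \<in> {1..q}}"

definition pair_prod :: "(nat \<Rightarrow> ('v, 'k::field) mpol) \<Rightarrow> nat multiset \<Rightarrow> ('v, 'k) mpol" where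
  "pair_prod m P = (\<Prod>i\<in>#P. m i)"

definition rels1 :: "nat \<Rightarrow> (nat multiset \<times> nat multiset set) set" where
  "rels1 q = {({#i, j#}, {{#j, j#}, {#i, a#}}) |i j a.
     i \<in> {1..q} \<and> j \<in> {1..q} \<and> a \<in> {1..q} \<and> i < j \<and> a \<notin> {i, j}}"

definition rels2 :: "nat \<Rightarrow> (nat multiset \<times> nat multiset set) set" where
  "rels2 q = {({#i, j#}, {{#i, i#}, {#j, b#}}) |i j b.
     i \<in> {1..q} \<and> j \<in> {1..q} \<and> b \<in> {1..q} \<and> i < j \<and> b \<noteq> i}"

definition rels3a :: "nat \<Rightarrow> nat \<Rightarrow> (nat multiset \<times> nat multiset set) set" where
  "rels3a q s = {({#1, j#}, (\<lambda>k. {#k, t k#}) ` {2..s}) |j t.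
     j \<in> {1..q} \<and> t ` {2..s} \<subseteq> {1..q} \<and> (\<forall>k\<in>{2..s}. t k \<in> {1, j, k}) \<and>
     j = 1}"

definition rels3b :: "nat \<Rightarrow> nat \<Rightarrow> (nat multiset \<times> nat multiset set) set" where
  "rels3b q s = {({#1, j#}, (\<lambda>k. {#k, t k#}) ` {2..s}) |j t.
     j \<in> {1..q} \<and> t ` {2..s} \<subseteq> {1..q} \<and> (\<forall>k\<in>{2..s}. t k \<in> {1, j, k}) \<and>
     j > s \<and> j \<in> t ` {2..s}}"

definition rels4a :: "nat \<Rightarrow> nat \<Rightarrow> (nat multiset \<times> nat multiset set) set" where
  "rels4a q s = {({#1, j#}, (\<lambda>k. {#k, t k#}) ` {2..s} \<union> {{#u, j#}}) |j u t.
     j \<in> {1..q} \<and> u \<in> {1..q} \<and> t ` {2..s} \<subseteq> {1..q} \<and>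
     j > s \<and> u > s \<and> j \<noteq> u \<and> (\<forall>k\<in>{2..s}. t k \<in> {1, k})}"

definition rels4b :: "nat \<Rightarrow> nat \<Rightarrow> (nat multiset \<times> nat multiset set) set" where
  "rels4b q s = {({#1, j#}, (\<lambda>k. {#k, t k#}) ` {2..s} \<union> {{#u, j#}}) |j u t.
     j \<in> {1..q} \<and> u \<in> {1..q} \<and> t ` {2..s} \<subseteq> {1..q} \<and>
     j = u \<and> u > 1 \<and> (\<forall>k\<in>{2..s}. t k > 1)}"

section \<open>Extremal ideals\<close>

text \<open>The variable \<open>y\<^sub>A\<close> is indexed by \<open>A\<close> itself. The definitions are meant for finite
  sets \<open>D\<close> of pairs \<open>(b, B)\<close> with \<open>b \<in> {1..q}\<close>, \<open>B \<subseteq> {1..q}\<close> and \<open>card B \<ge> 2\<close>.\<close>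

definition ext_vars :: "nat \<Rightarrow> nat set set" where
  "ext_vars q = Pow {1..q} - {{}}"

definition ext_Q :: "nat \<Rightarrow> (nat \<times> nat set) set \<Rightarrow> nat set set" where
  "ext_Q q D = {A. A \<subseteq> {1..q} \<and> A \<noteq> {} \<and> (\<forall>(b, B) \<in> D. b \<notin> A \<or> A \<inter> B \<noteq> {})}"

definition ext_gen :: "nat \<Rightarrow> (nat \<times> nat set) set \<Rightarrow> nat \<Rightarrow> (nat set, 'k::field) mpol" where
  "ext_gen q D i = (\<Prod>A \<in> {A \<in> ext_Q q D. i \<in> A}. var A)"

definition ext_ideal :: "nat \<Rightarrow> (nat \<times> nat set) set \<Rightarrow> (nat set, 'k::field) mpol set" where
  "ext_ideal q D = genideal (poly_ring (ext_vars q)) (ext_gen q D ` {1..q})"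

section \<open>Basic facts\<close>

lemma mono_of_eq_iff [simp]:
  "(mono_of s :: ('v, 'k::field) mpol) = mono_of t \<longleftrightarrow> s = t"
  unfolding mono_of_def by (metis lookup_single_eq lookup_single_not_eq zero_neq_one)

lemma mono_of_mult: "(mono_of s :: ('v, 'k::field) mpol) * mono_of t = mono_of (s + t)"
  by (simp add: mono_of_def mult_single)

lemma keys_mono_of_mult:
  fixes p :: "('v, 'k::field) mpol"
  shows "Poly_Mapping.keys (mono_of s * p) \<subseteq> (+) s ` Poly_Mapping.keys p"
  using keys_mult[of "mono_of s" p] by (auto simp: mono_of_def)

lemma mono_of_dvd_iff:
  "(mono_of s :: ('v, 'k::field) mpol) dvd mono_of t \<longleftrightarrow>
     (\<forall>v. Poly_Mapping.lookup s v \<le> Poly_Mapping.lookup t v)"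
proof
  assume "(mono_of s :: ('v, 'k) mpol) dvd mono_of t"
  then obtain p :: "('v, 'k) mpol" where p: "mono_of t = mono_of s * p" by (auto elim: dvdE)
  have "t \<in> Poly_Mapping.keys (mono_of t :: ('v, 'k) mpol)" by (simp add: mono_of_def)
  then obtain r where "t = s + r" using p keys_mono_of_mult[of s p] by auto
  then show "\<forall>v. Poly_Mapping.lookup s v \<le> Poly_Mapping.lookup t v" by (simp add: lookup_add)
next
  assume "\<forall>v. Poly_Mapping.lookup s v \<le> Poly_Mapping.lookup t v"
  then have "t = s + (t - s)"
    by (intro poly_mapping_eqI) (simp add: lookup_add lookup_minus)
  then show "(mono_of s :: ('v, 'k) mpol) dvd mono_of t" by (metis dvd_triv_left mono_of_mult)
qed

lemma mono_lcm_image: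
  fixes S :: "('v \<Rightarrow>\<^sub>0 nat) set"
  assumes "finite S" "S \<noteq> {}"
  obtains t where "(mono_lcm (mono_of ` S) :: ('v, 'k::field) mpol) = mono_of t"
    and "\<And>v. Poly_Mapping.lookup t v = (MAX s\<in>S. Poly_Mapping.lookup s v)"
proof -
  have S: "{Poly_Mapping.lookup s v |s. (mono_of s :: ('v, 'k) mpol) \<in> mono_of ` S} =
      (\<lambda>s. Poly_Mapping.lookup s v) ` S" for v
    by auto
  let ?f = "\<lambda>v. MAX s\<in>S. Poly_Mapping.lookup s v"
  have "{v. ?f v \<noteq> 0} \<subseteq> (\<Union>s\<in>S. Poly_Mapping.keys s)"
  proof
    fix v assume v: "v \<in> {v. ?f v \<noteq> 0}"
    have "?f v \<in> (\<lambda>s. Poly_Mapping.lookup s v) ` S" using assms by (intro Max_in) auto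
    then show "v \<in> (\<Union>s\<in>S. Poly_Mapping.keys s)" using v by (auto simp: in_keys_iff)
  qed
  then have "finite {v. ?f v \<noteq> 0}" using assms(1) by (auto intro: finite_subset)
  then have "Poly_Mapping.lookup (Poly_Mapping.Abs_poly_mapping ?f) = ?f"
    by (simp add: Abs_poly_mapping_inverse)
  then show ?thesis using that[of "Poly_Mapping.Abs_poly_mapping ?f"]
    by (simp add: mono_lcm_def S)
qed

lemma mono_lcm_dvd_iff:
  assumes "finite M" "M \<noteq> {}" "M \<subseteq> monomials UNIV"
  shows "mono_lcm M dvd mono_of r \<longleftrightarrow> (\<forall>p\<in>M. p dvd mono_of r)"
proof -
  define S where "S = {s. mono_of s \<in> M}"
  have M: "M = mono_of ` S" using assms(3) by (auto simp: S_def monomials_def)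
  have "inj_on mono_of S" by (auto intro: inj_onI)
  then have S: "finite S" "S \<noteq> {}" using assms M by (auto dest: finite_imageD)
  obtain t where t: "mono_lcm M = mono_of t"
      "\<And>v. Poly_Mapping.lookup t v = (MAX s\<in>S. Poly_Mapping.lookup s v)"
    using mono_lcm_image[OF S] M by metis
  have "mono_lcm M dvd mono_of r \<longleftrightarrow>
      (\<forall>s\<in>S. \<forall>v. Poly_Mapping.lookup s v \<le> Poly_Mapping.lookup r v)"
    using S by (auto simp: t mono_of_dvd_iff)
  also have "\<dots> \<longleftrightarrow> (\<forall>p\<in>M. p dvd mono_of r)"
    unfolding M by (simp add: mono_of_dvd_iff)
  finally show ?thesis .
qed

lemma carrier_poly_ring_mult:
  fixes p r :: "('v, 'k::field) mpol"
  assumes p: "p \<in> carrier (poly_ring V)" and r: "r \<in> carrier (poly_ring V)"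
  shows "p * r \<in> carrier (poly_ring V)"
proof -
  have "Poly_Mapping.keys w \<subseteq> V" if w: "w \<in> Poly_Mapping.keys (p * r)" for w
  proof -
    obtain a b where ab: "w = a + b" "a \<in> Poly_Mapping.keys p" "b \<in> Poly_Mapping.keys r"
      using w keys_mult[of p r] by blast
    then have "Poly_Mapping.keys a \<subseteq> V" "Poly_Mapping.keys b \<subseteq> V"
      using p r by (simp_all add: poly_ring_def)
    then show ?thesis using ab Poly_Mapping.keys_add[of a b] by blast
  qed
  then show ?thesis by (simp add: poly_ring_def)
qed

lemma cring_poly_ring: "cring (poly_ring V :: ('v, 'k::field) mpol ring)"
proof (rule cringI)
  show "abelian_group (poly_ring V :: ('v, 'k) mpol ring)"
  proof (rule abelian_groupI)
    fix p :: "('v, 'k) mpol" assume "p \<in> carrier (poly_ring V)"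
    then show "\<exists>y\<in>carrier (poly_ring V). y \<oplus>\<^bsub>poly_ring V\<^esub> p = \<zero>\<^bsub>poly_ring V\<^esub>"
      by (intro bexI[of _ "- p"]) (simp_all add: poly_ring_def)
  next
    fix p r :: "('v, 'k) mpol" assume "p \<in> carrier (poly_ring V)" "r \<in> carrier (poly_ring V)"
    then show "p \<oplus>\<^bsub>poly_ring V\<^esub> r \<in> carrier (poly_ring V)"
      using Poly_Mapping.keys_add[of p r] by (auto simp: poly_ring_def)
  qed (simp_all add: poly_ring_def add.commute add.left_commute add.assoc)
  show "Group.comm_monoid (poly_ring V :: ('v, 'k) mpol ring)"
  proof (rule comm_monoidI)
    fix p r :: "('v, 'k) mpol" assume "p \<in> carrier (poly_ring V)" "r \<in> carrier (poly_ring V)"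
    then show "p \<otimes>\<^bsub>poly_ring V\<^esub> r \<in> carrier (poly_ring V)"
      using carrier_poly_ring_mult by (simp add: poly_ring_def)
  qed (simp_all add: poly_ring_def mult.commute mult.left_commute mult.assoc)
qed (simp add: poly_ring_def distrib_right)

end

theory Submission
  imports Defs
begin

text \<open>A square-free monomial \<open>m i\<close> is determined by the variables dividing it, so a divisibility
  relation between products of two generators is a statement about pairs: for every variable \<open>v\<close>,
  with \<open>A\<close> the set of indices \<open>i\<close> such that \<open>v\<close> divides \<open>m i\<close>, some pair on the right
  meets \<open>A\<close> at least as often as the pair on the left does. The hypothesis on \<open>I\<close> says that
  every such \<open>A\<close> containing \<open>1\<close> meets \<open>{2..s}\<close>, which gives the relations (1)--(4). For an
  extremal ideal all sets \<open>A\<close> allowed by \<open>D\<close> occur, and testing a nontrivial relation on the sets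
  \<open>{j}\<close>, \<open>{i, j}\<close>, \<open>{1, k}\<close> and \<open>{1, k, j}\<close> already forces it to contain one of the
  listed ones. Since no listed relation has a singleton on the right, no product of two generators
  divides another one, hence these products generate the square minimally.\<close>

section \<open>Relations between pairs\<close>

definition pair_deg :: "'i set \<Rightarrow> 'i multiset \<Rightarrow> nat" where
  "pair_deg A P = size (filter_mset (\<lambda>i. i \<in> A) P)"

lemma pair_deg_pair [simp]: "pair_deg A {#i, j#} = of_bool (i \<in> A) + of_bool (j \<in> A)"
  by (simp add: pair_deg_def)

text \<open>Square-free monomials \<open>m i\<close> are described by the family \<open>F\<close> of the sets
  \<open>{i. y divides m i}\<close>, one for each variable \<open>y\<close>; the exponent of \<open>y\<close> in a product of two
  of them is \<^const>\<open>pair_deg\<close>.\<close>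

definition cover_rels :: "nat \<Rightarrow> nat set set \<Rightarrow> (nat multiset \<times> nat multiset set) set" where
  "cover_rels q F = {(P, B). P \<in> pairs q \<and> B \<noteq> {} \<and> B \<subseteq> pairs q \<and>
     (\<forall>A \<in> F. \<exists>R \<in> B. pair_deg A P \<le> pair_deg A R)}"

lemma pair_eq_iff: "{#i, j#} = {#k, l#} \<longleftrightarrow> i = k \<and> j = l \<or> i = l \<and> j = k"
  by (auto simp: add_eq_conv_ex)

lemma pair_in_pairs [simp]: "{#i, j#} \<in> pairs q \<longleftrightarrow> i \<in> {1..q} \<and> j \<in> {1..q}"
  by (auto simp: pairs_def pair_eq_iff)

lemma in_pairsE:
  assumes "P \<in> pairs q"
  obtains i j where "P = {#i, j#}" "i \<in> {1..q}" "j \<in> {1..q}"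
  using assms by (auto simp: pairs_def)

lemma finite_pairs [simp]: "finite (pairs q)"
proof -
  have "pairs q = (\<lambda>(i, j). {#i, j#}) ` ({1..q} \<times> {1..q})" by (force simp: pairs_def)
  then show ?thesis by simp
qed

section \<open>Validity of the listed relations\<close>

lemma rels12_eq:
  "rels1 q \<union> rels2 q = {({#i, j#}, {{#i, i#}, {#j, b#}}) |i j b.
     i \<in> {1..q} \<and> j \<in> {1..q} \<and> b \<in> {1..q} \<and> i \<noteq> j \<and> b \<noteq> i}" (is "_ = ?R")
proof
  have "r \<in> ?R" if r: "r \<in> rels1 q" for r
  proof -
    obtain i j a where "r = ({#i, j#}, {{#j, j#}, {#i, a#}})" "i \<in> {1..q}" "j \<in> {1..q}"
        "a \<in> {1..q}" "i < j" "a \<notin> {i, j}"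
      using r unfolding rels1_def by blast
    then have "r = ({#j, i#}, {{#j, j#}, {#i, a#}}) \<and> j \<in> {1..q} \<and> i \<in> {1..q} \<and> a \<in> {1..q} \<and>
        j \<noteq> i \<and> a \<noteq> j"
      by (simp add: add_mset_commute)
    then show ?thesis by blast
  qed
  moreover have "rels2 q \<subseteq> ?R" unfolding rels2_def by (blast dest: less_imp_neq)
  ultimately show "rels1 q \<union> rels2 q \<subseteq> ?R" by blast
  show "?R \<subseteq> rels1 q \<union> rels2 q"
  proof
    fix r assume "r \<in> ?R"
    then obtain i j b where r: "r = ({#i, j#}, {{#i, i#}, {#j, b#}})" "i \<in> {1..q}" "j \<in> {1..q}"
        "b \<in> {1..q}" "i \<noteq> j" "b \<noteq> i"
      by blast
    consider "i < j" | "j < i" "b = j" | "j < i" "b \<noteq> j" using r(5) by linarith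
    then show "r \<in> rels1 q \<union> rels2 q"
    proof cases
      case 1
      then show ?thesis using r unfolding rels2_def by blast
    next
      case 2
      then have "r = ({#j, i#}, {{#j, j#}, {#i, i#}})"
        using r by (simp add: add_mset_commute insert_commute)
      then show ?thesis using r 2 unfolding rels2_def by blast
    next
      case 3
      then have "r = ({#j, i#}, {{#i, i#}, {#j, b#}})" "b \<notin> {j, i}"
        using r by (simp_all add: add_mset_commute)
      then show ?thesis using r 3 unfolding rels1_def by blast
    qed
  qed
qed

text \<open>A set containing \<open>i\<close> meets \<open>{#i, i#}\<close> twice, the largest
  possible degree; a set without \<open>i\<close> meets \<open>{#i, j#}\<close> only through
  \<open>j\<close>, which \<open>{#j, b#}\<close> contains as well.\<close>

lemma rels12_subset_cover_rels: "rels1 q \<union> rels2 q \<subseteq> cover_rels q F"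
  unfolding rels12_eq cover_rels_def by auto

text \<open>The assumption on \<open>F\<close> is what divisibility of the lcm of
  \<open>m 2\<close>, ..., \<open>m s\<close> by \<open>m 1\<close> says about each
  variable.\<close>

context
  fixes q s :: nat and F :: "nat set set"
  assumes s: "3 \<le> s" "s \<le> q"
    and F: "\<And>A. A \<in> F \<Longrightarrow> 1 \<in> A \<Longrightarrow> \<exists>k\<in>{2..s}. k \<in> A"
begin

text \<open>If \<open>1 \<in> A\<close>, take \<open>k \<in> A\<close> from the hypothesis:
  whichever of \<open>1\<close>, \<open>j\<close>, \<open>k\<close> is \<open>t k\<close>, the
  degree of \<open>{#k, t k#}\<close> reaches that of \<open>{#1, j#}\<close>. If
  \<open>1 \<notin> A\<close>, only \<open>j\<close> counts on the left, and a pair with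
  \<open>t k = j\<close> covers it; for \<open>j = 1\<close> nothing remains to be covered.\<close>

lemma rels3_subset_cover_rels: "rels3a q s \<union> rels3b q s \<subseteq> cover_rels q F"
proof
  fix r assume "r \<in> rels3a q s \<union> rels3b q s"
  then obtain j t where r: "r = ({#1, j#}, (\<lambda>k. {#k, t k#}) ` {2..s})" "j \<in> {1..q}"
      "t ` {2..s} \<subseteq> {1..q}" "\<And>k. k \<in> {2..s} \<Longrightarrow> t k \<in> {1, j, k}" "j = 1 \<or> j \<in> t ` {2..s}"
    unfolding rels3a_def rels3b_def by blast
  have "\<exists>k\<in>{2..s}. pair_deg A {#1, j#} \<le> pair_deg A {#k, t k#}" if A: "A \<in> F" for A
  proof (cases "1 \<in> A")
    case True
    then obtain k where k: "k \<in> {2..s}" "k \<in> A" using F[OF A] by blast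
    then show ?thesis using r(4)[OF k(1)] True by (intro bexI[OF _ k(1)]) auto
  next
    case False
    show ?thesis
    proof (cases "j \<in> A")
      case True
      then obtain k where "k \<in> {2..s}" "t k = j" using r(5) False by auto
      then show ?thesis using True False by (intro bexI) auto
    next
      case nj: False
      \<comment> \<open>The left degree is zero here, so any pair serves.\<close>
      have "2 \<in> {2..s}" using s by simp
      then show ?thesis using nj False by (intro bexI) auto
    qed
  qed
  moreover have "{#k, t k#} \<in> pairs q" if "k \<in> {2..s}" for k
    using subsetD[OF r(3), of "t k"] s that by auto
  ultimately show "r \<in> cover_rels q F" using r(1,2) s unfolding cover_rels_def by auto
qed

text \<open>The pair \<open>{#u, j#}\<close> can fail only on a set \<open>A\<close> containing
  \<open>1\<close>, and the hypothesis then gives \<open>k \<in> A\<close>. In (4a)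
  \<open>t k\<close> lies in \<open>A\<close> too, so \<open>{#k, t k#}\<close> has degree two; in
  (4b), where \<open>u = j\<close>, the failure means \<open>j \<notin> A\<close>, and the single
  entry \<open>k\<close> suffices.\<close>

lemma rels4_subset_cover_rels: "rels4a q s \<union> rels4b q s \<subseteq> cover_rels q F"
proof
  fix r assume "r \<in> rels4a q s \<union> rels4b q s"
  then obtain j u t where r: "r = ({#1, j#}, (\<lambda>k. {#k, t k#}) ` {2..s} \<union> {{#u, j#}})"
      "j \<in> {1..q}" "u \<in> {1..q}" "t ` {2..s} \<subseteq> {1..q}"
      "j = u \<or> (\<forall>k\<in>{2..s}. t k \<in> {1, k})"
    unfolding rels4a_def rels4b_def by blast
  let ?B = "(\<lambda>k. {#k, t k#}) ` {2..s} \<union> {{#u, j#}}"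
  have "\<exists>R\<in>?B. pair_deg A {#1, j#} \<le> pair_deg A R" if A: "A \<in> F" for A
  proof (cases "pair_deg A {#1, j#} \<le> pair_deg A {#u, j#}")
    case False
    then have 1: "1 \<in> A" by (auto split: if_splits)
    obtain k where k: "k \<in> {2..s}" "k \<in> A" using 1 F[OF A] by blast
    have "j = u \<or> t k \<in> {1, k}" using r(5) k(1) by blast
    then have "j = u \<or> t k \<in> A" using k(2) 1 by auto
    then have "pair_deg A {#1, j#} \<le> pair_deg A {#k, t k#}" using False k 1 by auto
    then show ?thesis using k(1) by blast
  qed blast
  moreover have "{#k, t k#} \<in> pairs q" if "k \<in> {2..s}" for k
    using subsetD[OF r(4), of "t k"] s that by auto
  ultimately show "r \<in> cover_rels q F" using r(1-3) s unfolding cover_rels_def by auto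
qed

end

section \<open>Nontrivial relations over the families of extremal ideals\<close>

lemma ext_Q_empty: "ext_Q q {} = {A. A \<subseteq> {1..q} \<and> A \<noteq> {}}"
  by (auto simp: ext_Q_def)

lemma ext_Q_single:
  "ext_Q q {(1, {2..s})} = {A. A \<subseteq> {1..q} \<and> A \<noteq> {} \<and> (1 \<in> A \<longrightarrow> (\<exists>k\<in>{2..s}. k \<in> A))}"
  by (auto simp: ext_Q_def)

lemma cover_relsE:
  assumes "(P, B) \<in> cover_rels q F" "A \<in> F"
  obtains c d where "{#c, d#} \<in> B" "c \<in> {1..q}" "d \<in> {1..q}"
    "pair_deg A P \<le> of_bool (c \<in> A) + of_bool (d \<in> A)"
proof -
  obtain R where R: "R \<in> B" "B \<subseteq> pairs q" "pair_deg A P \<le> pair_deg A R"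
    using assms unfolding cover_rels_def by blast
  then obtain c d where "R = {#c, d#}" "c \<in> {1..q}" "d \<in> {1..q}" by (blast elim: in_pairsE)
  then show ?thesis using that R by simp
qed

text \<open>A pair of degree two lies entirely inside \<open>A\<close>; for a small test set
  \<open>A\<close> only a few such pairs exist.\<close>

lemma cover_rels_twoE:
  assumes "({#i, j#}, B) \<in> cover_rels q F" "A \<in> F" "i \<in> A" "j \<in> A"
  obtains c d where "{#c, d#} \<in> B" "c \<in> {1..q} \<inter> A" "d \<in> {1..q} \<inter> A"
proof (rule cover_relsE[OF assms(1,2)])
  fix c d
  assume "{#c, d#} \<in> B" "c \<in> {1..q}" "d \<in> {1..q}"
    "pair_deg A {#i, j#} \<le> of_bool (c \<in> A) + of_bool (d \<in> A)"
  then show ?thesis using that[of c d] assms(3,4)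
    by (cases "c \<in> A"; cases "d \<in> A") simp_all
qed

text \<open>The weaker test: only a positive degree is used, so one entry of the pair is located in
  \<open>A\<close> and its partner stays arbitrary.\<close>

lemma cover_rels_oneE:
  assumes "({#i, j#}, B) \<in> cover_rels q F" "A \<in> F" "i \<in> A \<or> j \<in> A"
  obtains c d where "{#c, d#} \<in> B" "c \<in> {1..q} \<inter> A" "d \<in> {1..q}"
proof (rule cover_relsE[OF assms(1,2)])
  fix c d
  assume cd: "{#c, d#} \<in> B" "c \<in> {1..q}" "d \<in> {1..q}"
    "pair_deg A {#i, j#} \<le> of_bool (c \<in> A) + of_bool (d \<in> A)"
  then have "c \<in> A \<or> d \<in> A" using assms(3) by (cases "c \<in> A"; cases "d \<in> A") auto
  then show ?thesis using that[of c d] that[of d c] cd by (auto simp: add_mset_commute)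
qed

lemma extendsI: "(P, B') \<in> L \<Longrightarrow> B' \<subseteq> B \<Longrightarrow> \<exists>r \<in> L. extension_of (P, B) r"
  by (rule bexI[of _ "(P, B')"]) (simp_all add: extension_of_def)

lemma extends_rels12:
  assumes "{#i, i#} \<in> B" "{#j, b#} \<in> B" "{#i, j#} \<notin> B"
    and "i \<in> {1..q}" "j \<in> {1..q}" "b \<in> {1..q}" "i \<noteq> j"
  shows "\<exists>r \<in> rels1 q \<union> rels2 q. extension_of ({#i, j#}, B) r"
proof -
  have "b \<noteq> i" using assms(2,3) by (metis add_mset_commute)
  then have "({#i, j#}, {{#i, i#}, {#j, b#}}) \<in> rels1 q \<union> rels2 q"
    unfolding rels12_eq using assms by blast
  then show ?thesis using assms(1,2) by (intro extendsI) auto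
qed

text \<open>\<open>{#i, i#}\<close> is the only pair inside \<open>{i}\<close>. Hence no nontrivial
  relation has this square on the left.\<close>

lemma cover_rels_square:
  assumes "({#i, i#}, B) \<in> cover_rels q F" "{i} \<in> F"
  shows "{#i, i#} \<in> B"
  by (rule cover_rels_twoE[OF assms]) simp_all

text \<open>Inside \<open>{i, j}\<close> lie only \<open>{#i, i#}\<close>, \<open>{#i, j#}\<close>
  and \<open>{#j, j#}\<close>, and the middle one is excluded by nontriviality. Once one square is
  present, the singleton of the other index supplies the second pair of a relation (1) or
  (2).\<close>

lemma cover_rels_extends_rels12:
  assumes PB: "({#i, j#}, B) \<in> cover_rels q F" "i \<noteq> j" "{#i, j#} \<notin> B"
    and "i \<in> {1..q}" "j \<in> {1..q}" and F: "{i} \<in> F" "{j} \<in> F" "{i, j} \<in> F"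
  shows "\<exists>r \<in> rels1 q \<union> rels2 q. extension_of ({#i, j#}, B) r"
proof -
  obtain c d where "{#c, d#} \<in> B" "c \<in> {i, j}" "d \<in> {i, j}"
    by (rule cover_rels_twoE[OF PB(1) F(3)]) auto
  then have "{#i, i#} \<in> B \<or> {#j, j#} \<in> B" using PB(3) by (auto simp: add_mset_commute)
  then show ?thesis
  proof
    assume "{#i, i#} \<in> B"
    moreover obtain b where "{#j, b#} \<in> B" "b \<in> {1..q}"
      by (rule cover_rels_oneE[OF PB(1) F(2)]) auto
    ultimately show ?thesis using extends_rels12[of i B j b q] assms by simp
  next
    assume "{#j, j#} \<in> B"
    moreover obtain b where "{#i, b#} \<in> B" "b \<in> {1..q}"
      by (rule cover_rels_oneE[OF PB(1) F(1)]) auto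
    ultimately show ?thesis
      using extends_rels12[of j B i b q] assms by (simp add: add_mset_commute)
  qed
qed

lemma cover_rels_empty_extends:
  assumes "(P, B) \<in> cover_rels q (ext_Q q {})" "P \<notin> B"
  shows "\<exists>r \<in> rels1 q \<union> rels2 q. extension_of (P, B) r"
proof -
  have "P \<in> pairs q" using assms(1) unfolding cover_rels_def by blast
  then obtain i j where P: "P = {#i, j#}" "i \<in> {1..q}" "j \<in> {1..q}" by (rule in_pairsE)
  then have "{i} \<in> ext_Q q {}" "{j} \<in> ext_Q q {}" "{i, j} \<in> ext_Q q {}"
    by (simp_all add: ext_Q_empty)
  moreover from this have "i \<noteq> j" using cover_rels_square assms P by blast
  ultimately show ?thesis using cover_rels_extends_rels12 assms P by blast
qed

text \<open>Collects the pairs found for the separate \<open>k\<close> into one function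
  \<open>t\<close>, the form in which (3) and (4) are stated; \<open>R\<close> carries the
  constraints on its values.\<close>

lemma pair_choice:
  assumes "\<And>k. k \<in> K \<Longrightarrow> \<exists>x. {#k, x#} \<in> B \<and> x \<in> X \<and> R k x"
  obtains t where "(\<lambda>k. {#k, t k#}) ` K \<subseteq> B" "t ` K \<subseteq> X" "\<forall>k\<in>K. R k (t k)"
proof -
  obtain t where "\<forall>k\<in>K. {#k, t k#} \<in> B \<and> t k \<in> X \<and> R k (t k)" using assms by metis
  then show ?thesis using that[of t] by blast
qed

lemma rels_intros:
  assumes "j \<in> {1..q}" "t ` {2..s} \<subseteq> {1..q}"
  shows rels3aI: "j = 1 \<Longrightarrow> \<forall>k\<in>{2..s}. t k \<in> {1, j, k} \<Longrightarrow>
      ({#1, j#}, (\<lambda>k. {#k, t k#}) ` {2..s}) \<in> rels3a q s"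
    and rels3bI: "s < j \<Longrightarrow> \<forall>k\<in>{2..s}. t k \<in> {1, j, k} \<Longrightarrow> j \<in> t ` {2..s} \<Longrightarrow>
      ({#1, j#}, (\<lambda>k. {#k, t k#}) ` {2..s}) \<in> rels3b q s"
    and rels4aI: "s < j \<Longrightarrow> s < u \<Longrightarrow> u \<in> {1..q} \<Longrightarrow> j \<noteq> u \<Longrightarrow> \<forall>k\<in>{2..s}. t k \<in> {1, k} \<Longrightarrow>
      ({#1, j#}, (\<lambda>k. {#k, t k#}) ` {2..s} \<union> {{#u, j#}}) \<in> rels4a q s"
    and rels4bI: "1 < j \<Longrightarrow> \<forall>k\<in>{2..s}. 1 < t k \<Longrightarrow>
      ({#1, j#}, (\<lambda>k. {#k, t k#}) ` {2..s} \<union> {{#j, j#}}) \<in> rels4b q s"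
  using assms unfolding rels3a_def rels3b_def rels4a_def rels4b_def by blast+

abbreviation rels_all :: "nat \<Rightarrow> nat \<Rightarrow> (nat multiset \<times> nat multiset set) set" where
  "rels_all q s \<equiv> rels1 q \<union> rels2 q \<union> rels3a q s \<union> rels3b q s \<union> rels4a q s \<union> rels4b q s"

text \<open>The type reached depends on how \<open>1\<close> occurs in \<open>P\<close>. Without
  \<open>1\<close>, the argument for empty \<open>D\<close> applies. For \<open>{#1, 1#}\<close> one
  finds (3a). For \<open>{#1, j#}\<close>, (1) or (2) occurs if \<open>B\<close> contains
  \<open>{#1, 1#}\<close>, or \<open>{#j, j#}\<close> together with a pair containing
  \<open>1\<close>; \<open>{#j, j#}\<close> without such a pair gives (4b); if both squares are
  missing, (3b) or (4a) remains.\<close>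

lemma cover_rels_single_extends:
  assumes PB: "(P, B) \<in> cover_rels q (ext_Q q {(1, {2..s})})" and nB: "P \<notin> B"
    and s: "3 \<le> s" "s \<le> q"
  shows "\<exists>r \<in> rels_all q s. extension_of (P, B) r"
proof -
  let ?F = "ext_Q q {(1, {2..s})}"
  have F1: "A \<in> ?F" if "A \<subseteq> {1..q}" "k \<in> A" "k \<in> {2..s}" for A k
    using that unfolding ext_Q_single by blast
  have F2: "A \<in> ?F" if "A \<subseteq> {2..q}" "A \<noteq> {}" for A
    using that unfolding ext_Q_single by force
  have "P \<in> pairs q" using PB unfolding cover_rels_def by blast
  then obtain i j where "P = {#i, j#}" "i \<in> {1..q}" "j \<in> {1..q}" by (rule in_pairsE)
  then consider "P = {#1, 1#}"
    | j where "P = {#1, j#}" "j \<in> {2..q}"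
    | i j where "P = {#i, j#}" "i \<in> {2..q}" "j \<in> {2..q}" "i \<noteq> j"
    | i where "P = {#i, i#}" "i \<in> {2..q}"
  proof -
    have "i \<in> {2..q}" if "i \<noteq> 1" using that \<open>i \<in> {1..q}\<close> by simp
    moreover have "j \<in> {2..q}" if "j \<noteq> 1" using that \<open>j \<in> {1..q}\<close> by simp
    moreover have "P = {#j, i#}" using \<open>P = {#i, j#}\<close> by (simp add: add_mset_commute)
    ultimately show thesis using \<open>P = {#i, j#}\<close> that by metis
  qed
  then show ?thesis
  proof cases
    case 1
    have "\<exists>x. {#k, x#} \<in> B \<and> x \<in> {1..q} \<and> x \<in> {1, 1, k}" if k: "k \<in> {2..s}" for k
    proof -
      \<comment> \<open>A pair inside \<open>{1, k}\<close> other than \<open>{#1, 1#}\<close> has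
        \<open>k\<close> as an entry.\<close>
      have "{1, k} \<in> ?F" using F1[of "{1, k}" k] k s by auto
      then obtain c d where cd: "{#c, d#} \<in> B" "c \<in> {1..q} \<inter> {1, k}" "d \<in> {1..q} \<inter> {1, k}"
        by (rule cover_rels_twoE[OF PB[unfolded 1(1)]]) auto
      then show ?thesis using nB 1 by (auto simp: add_mset_commute)
    qed
    then obtain t where t: "(\<lambda>k. {#k, t k#}) ` {2..s} \<subseteq> B" "t ` {2..s} \<subseteq> {1..q}"
        "\<forall>k\<in>{2..s}. t k \<in> {1, 1, k}"
      by (rule pair_choice[of "{2..s}" B "{1..q}" "\<lambda>k x. x \<in> {1, 1, k}"])
    have "({#1, 1#}, (\<lambda>k. {#k, t k#}) ` {2..s}) \<in> rels3a q s"
      by (rule rels3aI) (use t s in auto)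
    then have "\<exists>r \<in> rels3a q s. extension_of (P, B) r"
      unfolding 1(1) by (rule extendsI) (use t(1) in simp_all)
    then show ?thesis by blast
  next
    case (2 j)
    have nP: "{#1, j#} \<notin> B" using nB 2(1) by simp
    then have nP: "{#1, j#} \<notin> B" "{#j, 1#} \<notin> B" by (simp_all add: add_mset_commute)
    have Fj: "{j} \<in> ?F" using F2[of "{j}"] 2 by auto
    obtain b where b: "{#j, b#} \<in> B" "b \<in> {1..q}"
      by (rule cover_rels_oneE[OF PB[unfolded 2(1)] Fj]) auto
    show ?thesis
    proof (cases "{#1, 1#} \<in> B")
      case True
      then have "\<exists>r \<in> rels1 q \<union> rels2 q. extension_of (P, B) r"
        using extends_rels12[of 1 B j b q] b nB 2 s by auto
      then show ?thesis by blast
    next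
      case n11: False
      show ?thesis
      proof (cases "{#j, j#} \<in> B")
        case jj: True
        show ?thesis
        proof (cases "\<exists>a. {#1, a#} \<in> B")
          case True
          then obtain a where a: "{#1, a#} \<in> B" by blast
          moreover have "B \<subseteq> pairs q" using PB unfolding cover_rels_def by blast
          ultimately have "a \<in> {1..q}" by auto
          moreover have P: "P = {#j, 1#}" using 2 by (simp add: add_mset_commute)
          ultimately have "\<exists>r \<in> rels1 q \<union> rels2 q. extension_of (P, B) r"
            unfolding P using a 2(2) nB[unfolded P] s
            by (intro extends_rels12[of j B 1 a q] jj) auto
          then show ?thesis by blast
        next
          case n1: False
          have "\<exists>x. {#k, x#} \<in> B \<and> x \<in> {1..q} \<and> 1 < x" if k: "k \<in> {2..s}" for k
          proof -
            \<comment> \<open>One entry lies in \<open>{1, k}\<close>; as no pair of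
              \<open>B\<close> contains \<open>1\<close>, it is \<open>k\<close>, and its partner
              exceeds \<open>1\<close>.\<close>
            have "{1, k} \<in> ?F" using F1[of "{1, k}" k] k s by auto
            then obtain c d where cd: "{#c, d#} \<in> B" "c \<in> {1..q} \<inter> {1, k}" "d \<in> {1..q}"
              by (rule cover_rels_oneE[OF PB[unfolded 2(1)]]) auto
            have "{#d, c#} \<in> B" using cd(1) by (simp add: add_mset_commute)
            then have "c \<noteq> 1" "d \<noteq> 1" using cd(1) n1 by blast+
            then have "c = k" "1 < d" using cd(2,3) by auto
            then show ?thesis using cd(1,3) by blast
          qed
          then obtain t where t: "(\<lambda>k. {#k, t k#}) ` {2..s} \<subseteq> B" "t ` {2..s} \<subseteq> {1..q}"
              "\<forall>k\<in>{2..s}. 1 < t k"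
            by (rule pair_choice[of "{2..s}" B "{1..q}" "\<lambda>k x. 1 < x"])
          have "({#1, j#}, (\<lambda>k. {#k, t k#}) ` {2..s} \<union> {{#j, j#}}) \<in> rels4b q s"
            by (rule rels4bI) (use t 2 in auto)
          then have "\<exists>r \<in> rels4b q s. extension_of (P, B) r"
            unfolding 2(1) by (rule extendsI) (use t(1) jj in simp_all)
          then show ?thesis by blast
        qed
      next
        case njj: False
        \<comment> \<open>For \<open>j \<le> s\<close> the set \<open>{1, j}\<close> would be
          allowed, but all three pairs inside it are missing from \<open>B\<close>.\<close>
        have js: "s < j"
        proof (rule ccontr)
          assume "\<not> s < j"
          then have "{1, j} \<in> ?F" using F1[of "{1, j}" j] 2 s by auto
          then obtain c d where cd: "{#c, d#} \<in> B" "c \<in> {1..q} \<inter> {1, j}" "d \<in> {1..q} \<inter> {1, j}"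
            by (rule cover_rels_twoE[OF PB[unfolded 2(1)]]) auto
          then show False using nB 2 n11 njj by (auto simp: add_mset_commute)
        qed
        \<comment> \<open>The pairs formed from \<open>1\<close> and \<open>j\<close> alone are
          missing from \<open>B\<close>, so a pair inside \<open>{1, k, j}\<close> has
          \<open>k\<close> as an entry.\<close>
        have k1: "\<exists>x. {#k, x#} \<in> B \<and> x \<in> {1..q} \<and> x \<in> {1, j, k}" if k: "k \<in> {2..s}" for k
        proof -
          have "{1, k, j} \<in> ?F" using F1[of "{1, k, j}" k] k s 2 by auto
          then obtain c d where cd: "{#c, d#} \<in> B" "c \<in> {1..q} \<inter> {1, k, j}" "d \<in> {1..q} \<inter> {1, k, j}"
            by (rule cover_rels_twoE[OF PB[unfolded 2(1)]]) auto
          have "{#d, c#} \<in> B" using cd(1) by (simp only: add_mset_commute)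
          moreover have "c = k \<or> d = k" using cd nP n11 njj by blast
          ultimately show ?thesis using cd by blast
        qed
        \<comment> \<open>\<open>b\<close> is the partner of \<open>j\<close> found by testing
          \<open>{j}\<close>; it serves as \<open>u\<close> in (4a).\<close>
        have "b \<noteq> j" using njj b by blast
        moreover have "b \<noteq> 1" using b(1) nP(2) by blast
        ultimately have bj: "b \<noteq> j" "b \<noteq> 1" .
        have bj': "{#b, j#} \<in> B" using b(1) by (simp only: add_mset_commute)
        show ?thesis
        proof (cases "\<exists>k\<in>{2..s}. {#k, j#} \<in> B")
          case True
          then obtain k' where k': "k' \<in> {2..s}" "{#k', j#} \<in> B" by blast
          \<comment> \<open>Relation (3b) requires \<open>j\<close> among the values of
            \<open>t\<close>, so the choice at \<open>k'\<close> is pinned to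
            \<open>j\<close>.\<close>
          have "\<exists>x. {#k, x#} \<in> B \<and> x \<in> {1..q} \<and> x \<in> {1, j, k} \<and> (k = k' \<longrightarrow> x = j)"
            if k: "k \<in> {2..s}" for k
            using k1[OF k] k' 2 by (cases "k = k'") auto
          then obtain t where t: "(\<lambda>k. {#k, t k#}) ` {2..s} \<subseteq> B" "t ` {2..s} \<subseteq> {1..q}"
              "\<forall>k\<in>{2..s}. t k \<in> {1, j, k} \<and> (k = k' \<longrightarrow> t k = j)"
            by (rule pair_choice[of "{2..s}" B "{1..q}"
                  "\<lambda>k x. x \<in> {1, j, k} \<and> (k = k' \<longrightarrow> x = j)"])
          have "j \<in> t ` {2..s}" using t(3) k' by force
          then have "({#1, j#}, (\<lambda>k. {#k, t k#}) ` {2..s}) \<in> rels3b q s"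
            by (intro rels3bI) (use t 2 js in auto)
          then have "\<exists>r \<in> rels3b q s. extension_of (P, B) r"
            unfolding 2(1) by (rule extendsI) (use t(1) in simp_all)
          then show ?thesis by blast
        next
          case False
          then have "\<exists>x. {#k, x#} \<in> B \<and> x \<in> {1..q} \<and> x \<in> {1, k}" if k: "k \<in> {2..s}" for k
            using k1[OF k] k by auto
          then obtain t where t: "(\<lambda>k. {#k, t k#}) ` {2..s} \<subseteq> B" "t ` {2..s} \<subseteq> {1..q}"
              "\<forall>k\<in>{2..s}. t k \<in> {1, k}"
            by (rule pair_choice[of "{2..s}" B "{1..q}" "\<lambda>k x. x \<in> {1, k}"])
          \<comment> \<open>If \<open>b \<le> s\<close>, then \<open>{#b, j#}\<close> would be one
            of the pairs ruled out in this case.\<close>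
          have "s < b" using False bj bj' b by (cases "s < b") auto
          then have "({#1, j#}, (\<lambda>k. {#k, t k#}) ` {2..s} \<union> {{#b, j#}}) \<in> rels4a q s"
            by (intro rels4aI) (use t 2 js b bj in auto)
          then have "\<exists>r \<in> rels4a q s. extension_of (P, B) r"
            unfolding 2(1) by (rule extendsI) (use t(1) bj' in simp_all)
          then show ?thesis by blast
        qed
      qed
    qed
  next
    case (3 i j)
    have "{i} \<in> ?F" "{j} \<in> ?F" "{i, j} \<in> ?F"
      using F2[of "{i}"] F2[of "{j}"] F2[of "{i, j}"] 3 by auto
    then have "\<exists>r \<in> rels1 q \<union> rels2 q. extension_of (P, B) r"
      using cover_rels_extends_rels12[OF PB[unfolded 3(1)]] nB 3 by auto
    then show ?thesis by blast
  next
    case (4 i)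
    have "{i} \<in> ?F" using F2[of "{i}"] 4 by auto
    then show ?thesis using cover_rels_square[OF PB[unfolded 4(1)]] nB 4(1) by blast
  qed
qed

section \<open>Minimality\<close>

text \<open>Extension is a partial order, and whatever lies below a nontrivial relation is
  nontrivial. So a relation strictly below a member of \<open>L\<close> has a member of
  \<open>L\<close> below it in turn, and minimality can be decided inside \<open>L\<close>.\<close>

lemma min_div_rels_eqI:
  assumes "L \<subseteq> div_rels \<Lambda> u" "\<And>r. r \<in> L \<Longrightarrow> \<not> trivial_rel r"
    and "\<And>r. r \<in> div_rels \<Lambda> u \<Longrightarrow> \<not> trivial_rel r \<Longrightarrow> \<exists>r'\<in>L. extension_of r r'"
  shows "min_div_rels \<Lambda> u = {r \<in> L. \<forall>r'\<in>L. r' \<noteq> r \<longrightarrow> \<not> extension_of r r'}"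
proof -
  have trans: "extension_of r r''" if "extension_of r r'" "extension_of r' r''"
    for r r' r'' :: "'a \<times> 'a set"
    using that unfolding extension_of_def by auto
  have antisym: "r = r'" if "extension_of r r'" "extension_of r' r" for r r' :: "'a \<times> 'a set"
    using that unfolding extension_of_def by (auto simp: prod_eq_iff)
  have triv: "\<not> trivial_rel r'" if "extension_of r r'" "\<not> trivial_rel r"
    for r r' :: "'a \<times> 'a set"
    using that unfolding extension_of_def trivial_rel_def by auto
  show ?thesis
  proof (intro equalityI subsetI)
    fix r assume r: "r \<in> min_div_rels \<Lambda> u"
    then have "r \<in> div_rels \<Lambda> u" "\<not> trivial_rel r"
      and m: "\<And>r'. r' \<in> div_rels \<Lambda> u \<Longrightarrow> r' \<noteq> r \<Longrightarrow> \<not> extension_of r r'"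
      unfolding min_div_rels_def by auto
    then show "r \<in> {r \<in> L. \<forall>r'\<in>L. r' \<noteq> r \<longrightarrow> \<not> extension_of r r'}"
      using assms by blast
  next
    fix r assume r: "r \<in> {r \<in> L. \<forall>r'\<in>L. r' \<noteq> r \<longrightarrow> \<not> extension_of r r'}"
    have "\<not> extension_of r r'" if r': "r' \<in> div_rels \<Lambda> u" "r' \<noteq> r" for r'
    proof
      assume e: "extension_of r r'"
      then have "\<not> trivial_rel r'" using triv r assms(2) by blast
      then obtain r'' where r'': "r'' \<in> L" "extension_of r' r''" using assms(3) r' by blast
      then have "r'' = r" using r trans[OF e r''(2)] by blast
      then show False using antisym[OF e] r''(2) r'(2) by simp
    qed
    then show "r \<in> min_div_rels \<Lambda> u" using r assms unfolding min_div_rels_def by blast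
  qed
qed

section \<open>Shape and mutual comparison of the listed relations\<close>

lemma pair_in_image_iff:
  "{#x, y#} \<in> (\<lambda>k. {#k, t k#}) ` K \<longleftrightarrow> x \<in> K \<and> t x = y \<or> y \<in> K \<and> t y = x"
  unfolding image_iff pair_eq_iff by blast

lemma rels12E:
  assumes "(P, B) \<in> rels1 q \<union> rels2 q"
  obtains i j b where "P = {#i, j#}" "B = {{#i, i#}, {#j, b#}}" "i \<noteq> j" "b \<noteq> i"
  using assms unfolding rels12_eq by blast

lemma rels3aE:
  assumes "(P, B) \<in> rels3a q s"
  obtains t where "P = {#1, 1#}" "B = (\<lambda>k. {#k, t k#}) ` {2..s}" "\<forall>k\<in>{2..s}. t k \<in> {1, k}"
proof -
  obtain j t where "(P, B) = ({#1, j#}, (\<lambda>k. {#k, t k#}) ` {2..s})" "j = 1"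
      "\<forall>k\<in>{2..s}. t k \<in> {1, j, k}"
    using assms unfolding rels3a_def by blast
  then show ?thesis using that[of t] by simp
qed

lemma rels3bE:
  assumes "(P, B) \<in> rels3b q s"
  obtains j t where "P = {#1, j#}" "B = (\<lambda>k. {#k, t k#}) ` {2..s}" "s < j"
    "\<forall>k\<in>{2..s}. t k \<in> {1, j, k}" "j \<in> t ` {2..s}"
proof -
  obtain j t where "(P, B) = ({#1, j#}, (\<lambda>k. {#k, t k#}) ` {2..s})" "s < j"
      "\<forall>k\<in>{2..s}. t k \<in> {1, j, k}" "j \<in> t ` {2..s}"
    using assms unfolding rels3b_def by blast
  then show ?thesis using that[of j t] by simp
qed

lemma rels4aE:
  assumes "(P, B) \<in> rels4a q s"
  obtains j u t where "P = {#1, j#}" "B = (\<lambda>k. {#k, t k#}) ` {2..s} \<union> {{#u, j#}}"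
    "s < j" "s < u" "j \<noteq> u" "\<forall>k\<in>{2..s}. t k \<in> {1, k}"
proof -
  obtain j u t where "(P, B) = ({#1, j#}, (\<lambda>k. {#k, t k#}) ` {2..s} \<union> {{#u, j#}})"
      "s < j" "s < u" "j \<noteq> u" "\<forall>k\<in>{2..s}. t k \<in> {1, k}"
    using assms unfolding rels4a_def by blast
  then show ?thesis using that[of j t u] by simp
qed

lemma rels4bE:
  assumes "(P, B) \<in> rels4b q s"
  obtains j t where "P = {#1, j#}" "B = (\<lambda>k. {#k, t k#}) ` {2..s} \<union> {{#j, j#}}"
    "1 < j" "\<forall>k\<in>{2..s}. 1 < t k"
proof -
  obtain j u t where "(P, B) = ({#1, j#}, (\<lambda>k. {#k, t k#}) ` {2..s} \<union> {{#u, j#}})"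
      "j = u" "1 < u" "\<forall>k\<in>{2..s}. 1 < t k"
    using assms unfolding rels4b_def by blast
  then show ?thesis using that[of j t] by simp
qed

lemma rels12_nontrivial:
  assumes "r \<in> rels1 q \<union> rels2 q"
  shows "\<not> trivial_rel r"
proof -
  obtain P B where r: "r = (P, B)" by force
  show ?thesis
    by (rule rels12E[OF assms[unfolded r]]) (auto simp: r trivial_rel_def pair_eq_iff)
qed

text \<open>The entries \<open>k\<close>, \<open>t k\<close> and \<open>j\<close> all exceed
  \<open>1\<close>. This separates right sides of (4b) from the left side \<open>{#1, j#}\<close>
  and from those of (1) and (2) with \<open>1\<close> on the left.\<close>

lemma rels4b_one_notin:
  assumes "(P, B) \<in> rels4b q s" "R \<in> B"
  shows "1 \<notin># R"
proof (rule rels4bE[OF assms(1)])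
  fix j t
  assume B: "B = (\<lambda>k. {#k, t k#}) ` {2..s} \<union> {{#j, j#}}" and j: "1 < j"
    and t: "\<forall>k\<in>{2..s}. 1 < t k"
  have "1 \<notin># {#k, t k#}" if "k \<in> {2..s}" for k using bspec[OF t that] that by auto
  then show ?thesis using assms(2) j unfolding B by auto
qed

lemma rels_all_cases [consumes 1]:
  assumes "r \<in> rels_all q s"
  obtains (rels12) "r \<in> rels1 q \<union> rels2 q" | (rels3a) "r \<in> rels3a q s"
    | (rels3b) "r \<in> rels3b q s" | (rels4a) "r \<in> rels4a q s" | (rels4b) "r \<in> rels4b q s"
  using assms by blast

text \<open>In (3) and (4a) neither \<open>1\<close> nor \<open>j\<close> lies in
  \<open>{2..s}\<close>, so \<open>{#1, j#}\<close> is no \<open>{#k, t k#}\<close>, and in (4a)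
  also \<open>u\<close> differs from \<open>1\<close>; in (4b) the entry \<open>1\<close> never
  occurs on the right.\<close>

lemma rels_all_nontrivial:
  assumes "r \<in> rels_all q s" "3 \<le> s"
  shows "\<not> trivial_rel r"
  using assms(1)
proof (cases rule: rels_all_cases)
  case rels12
  then show ?thesis by (rule rels12_nontrivial)
next
  obtain P B where r: "r = (P, B)" by force
  {
    case rels3a
    then show ?thesis unfolding r
      by (rule rels3aE) (auto simp: trivial_rel_def pair_in_image_iff)
  next
    case rels3b
    then show ?thesis unfolding r
      by (rule rels3bE) (auto simp: trivial_rel_def pair_in_image_iff)
  next
    case rels4a
    then show ?thesis unfolding r
      by (rule rels4aE) (use assms(2) in \<open>auto simp: trivial_rel_def pair_in_image_iff pair_eq_iff\<close>)
  next
    case rels4b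
    then have "1 \<in># P" unfolding r by (rule rels4bE) simp
    then show ?thesis using rels4b_one_notin[of P B] rels4b by (auto simp: r trivial_rel_def)
  }
qed

lemma rels12_not_subset_singleton:
  assumes "(P, B) \<in> rels1 q \<union> rels2 q"
  shows "\<not> B \<subseteq> {R}"
  by (rule rels12E[OF assms]) (auto simp: pair_eq_iff)

text \<open>\<open>{#2, t 2#}\<close> and \<open>{#3, t 3#}\<close> coincide only as
  \<open>{#2, 3#}\<close>. The constraint on \<open>t 2\<close> excludes this in (3) and (4a), the
  square \<open>{#j, j#}\<close> in (4b). This is what keeps a product of two generators from
  dividing another one.\<close>

lemma rels_all_not_subset_singleton:
  assumes r: "(P, B) \<in> rels_all q s" and s: "3 \<le> s"
  shows "\<not> B \<subseteq> {R}"
proof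
  assume B: "B \<subseteq> {R}"
  have 23: "2 \<in> {2..s}" "3 \<in> {2..s}" using s by auto
  have t: "t 2 = 3" "t 3 = 2" if "(\<lambda>k. {#k, t k#}) ` {2..s} \<subseteq> B" for t
  proof -
    have "{#2, t 2#} = R" "{#3, t 3#} = R" using that B 23 by blast+
    then have "{#2, t 2#} = {#3, t 3#}" by simp
    then show "t 2 = 3" "t 3 = 2" by (auto simp: pair_eq_iff)
  qed
  show False using r
  proof (cases rule: rels_all_cases)
    case rels12
    then show ?thesis using rels12_not_subset_singleton B by blast
  next
    case rels3a
    then show ?thesis
    proof (rule rels3aE)
      fix t assume "B = (\<lambda>k. {#k, t k#}) ` {2..s}" "\<forall>k\<in>{2..s}. t k \<in> {1, k}"
      then have "t 2 = 3" "t 2 \<in> {1, 2}" using t[of t] 23 by blast+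
      then show False by auto
    qed
  next
    case rels3b
    then show ?thesis
    proof (rule rels3bE)
      fix j t
      assume "B = (\<lambda>k. {#k, t k#}) ` {2..s}" "s < j" "\<forall>k\<in>{2..s}. t k \<in> {1, j, k}"
      then have "t 2 = 3" "t 2 \<in> {1, j, 2}" using t[of t] 23 by blast+
      then show False using \<open>s < j\<close> s by auto
    qed
  next
    case rels4a
    then show ?thesis
    proof (rule rels4aE)
      fix j u t
      assume "B = (\<lambda>k. {#k, t k#}) ` {2..s} \<union> {{#u, j#}}" "\<forall>k\<in>{2..s}. t k \<in> {1, k}"
      then have "t 2 = 3" "t 2 \<in> {1, 2}" using t[of t] 23 by blast+
      then show False by auto
    qed
  next
    case rels4b
    then show ?thesis
    proof (rule rels4bE)
      fix j t
      assume B': "B = (\<lambda>k. {#k, t k#}) ` {2..s} \<union> {{#j, j#}}"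
      then have "{#2, t 2#} = R" "{#j, j#} = R" using B 23 by blast+
      then have "{#2, t 2#} = {#j, j#}" by simp
      then show False using t[of t] B' by (auto simp: pair_eq_iff)
    qed
  qed
qed

lemma rels12_minimal:
  assumes r: "(P, B) \<in> rels1 q \<union> rels2 q" and sub: "B' \<subseteq> B"
    and single: "\<And>R. \<not> B' \<subseteq> {R}"
  shows "B' = B"
proof -
  obtain X Y where "B = {X, Y}" using r unfolding rels12_eq by blast
  then show ?thesis using sub single[of X] single[of Y] by blast
qed

text \<open>In the common shape of (1) and (2) the squared index is \<open>1\<close> or
  \<open>j\<close>. The resulting pairs reveal these types when \<open>1\<close> occurs on the
  left.\<close>

lemma rels12_at_one:
  assumes "({#1, j#}, B) \<in> rels1 q \<union> rels2 q"
  shows "j \<noteq> 1" "{#1, 1#} \<in> B \<or> {#j, j#} \<in> B \<and> (\<exists>b. {#1, b#} \<in> B)"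
proof -
  obtain i l b where "{#1, j#} = {#i, l#}" "B = {{#i, i#}, {#l, b#}}" "i \<noteq> l"
    using assms unfolding rels12_eq by blast
  then show "j \<noteq> 1" "{#1, 1#} \<in> B \<or> {#j, j#} \<in> B \<and> (\<exists>b. {#1, b#} \<in> B)"
    by (auto simp: pair_eq_iff)
qed

text \<open>Lets \<open>t\<close> be read off from its set of pairs. If \<open>{#k, x#}\<close>
  arose from the index \<open>x\<close> instead, then \<open>t x = k\<close>; since
  \<open>k \<in> K\<close> is not in \<open>X\<close>, this forces \<open>k = x\<close>.\<close>

lemma pair_image_eq:
  assumes "{#k, x#} \<in> (\<lambda>k. {#k, t k#}) ` K" "k \<in> K" "\<forall>k\<in>K. t k \<in> insert k X" "X \<inter> K = {}"
  shows "x = t k"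
proof (rule ccontr)
  assume "x \<noteq> t k"
  then have x: "x \<in> K" "t x = k" using assms(1) unfolding pair_in_image_iff by auto
  then have "k \<in> insert x X" using bspec[OF assms(3) x(1)] by simp
  then have "k = x" using assms(2,4) by auto
  then show False using x(2) \<open>x \<noteq> t k\<close> by simp
qed

text \<open>A listed relation below one with left side \<open>{#1, 1#}\<close> must again be of type
  (3a), and there the right side determines \<open>t\<close>.\<close>

lemma rels3a_minimal:
  assumes r: "(P, B) \<in> rels3a q s" and r': "(P, B') \<in> rels_all q s" and sub: "B' \<subseteq> B"
  shows "B' = B"
proof (rule rels3aE[OF r])
  fix t assume P: "P = {#1, 1#}" and B: "B = (\<lambda>k. {#k, t k#}) ` {2..s}"
    and t: "\<forall>k\<in>{2..s}. t k \<in> {1, k}"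
  have "(P, B') \<in> rels3a q s" using r'
  proof (cases rule: rels_all_cases)
    case rels12
    then show ?thesis unfolding P using rels12_at_one(1) by blast
  next
    case rels3b
    then show ?thesis
    proof (rule rels3bE)
      fix j t assume "P = {#1, j#}" "s < j" "j \<in> t ` {2..s}"
      then show ?thesis unfolding P by (auto simp: pair_eq_iff)
    qed
  next
    case rels4a
    then show ?thesis
    proof (rule rels4aE)
      fix j u t
      assume j: "P = {#1, j#}" "s < j" and B': "B' = (\<lambda>k. {#k, t k#}) ` {2..s} \<union> {{#u, j#}}"
      \<comment> \<open>\<open>j = 1\<close> together with \<open>s < j\<close> makes
        \<open>{2..s}\<close> empty, while \<open>B'\<close> still contains
        \<open>{#u, j#}\<close>.\<close>
      then have "B = {}" unfolding P B by (auto simp: pair_eq_iff)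
      then show ?thesis using sub B' by simp
    qed
  next
    case rels4b
    then show ?thesis
    proof (rule rels4bE)
      fix j assume "P = {#1, j#}" "1 < j"
      then show ?thesis unfolding P by (auto simp: pair_eq_iff)
    qed
  qed
  then show ?thesis
  proof (rule rels3aE)
    fix t' assume B': "B' = (\<lambda>k. {#k, t' k#}) ` {2..s}"
    have tt: "t' k = t k" if "k \<in> {2..s}" for k
    proof (rule pair_image_eq[OF _ that, of _ _ "{1}"])
      show "{#k, t' k#} \<in> (\<lambda>k. {#k, t k#}) ` {2..s}" using sub that unfolding B B' by blast
    qed (use t in auto)
    then show "B' = B" unfolding B B' by (intro image_cong refl) (simp only: tt)
  qed
qed

text \<open>For relations (3b) and (4a) with left side \<open>{#1, j#}\<close> the set \<open>B\<close> contains neither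
  \<open>{#1, 1#}\<close> nor \<open>{#j, j#}\<close>, while (1), (2) and (4b) require one of them. Types (3b) and (4a)
  are told apart by the partner of \<open>j\<close>, which is at most \<open>s\<close> in (3b) and above \<open>s\<close> in (4a).\<close>

lemma rels3b_minimal:
  assumes r: "(P, B) \<in> rels3b q s" and r': "(P, B') \<in> rels_all q s" and sub: "B' \<subseteq> B"
  shows "B' = B"
proof (rule rels3bE[OF r])
  fix j t assume P: "P = {#1, j#}" and B: "B = (\<lambda>k. {#k, t k#}) ` {2..s}" and j: "s < j"
    and t: "\<forall>k\<in>{2..s}. t k \<in> {1, j, k}" and jt: "j \<in> t ` {2..s}"
  have sq: "{#1, 1#} \<notin> B" "{#j, j#} \<notin> B" "{#u, j#} \<notin> B" if "s < u" for u
    using j that unfolding B by (auto simp: pair_in_image_iff)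
  have "j \<noteq> 1" using j jt by auto
  have j': "j' = j" if "P = {#1, j'#}" for j' using that unfolding P by (auto simp: pair_eq_iff)
  have "(P, B') \<in> rels3b q s" using r'
  proof (cases rule: rels_all_cases)
    case rels12
    then show ?thesis unfolding P using rels12_at_one(2) sq[OF j] sub by blast
  next
    case rels3a
    then show ?thesis by (rule rels3aE) (use j' \<open>j \<noteq> 1\<close> in blast)
  next
    case rels4a
    then show ?thesis by (rule rels4aE) (use j' sq(3) sub in blast)
  next
    case rels4b
    then show ?thesis by (rule rels4bE) (use j' sq(2)[OF j] sub in blast)
  qed
  then show ?thesis
  proof (rule rels3bE)
    fix j' t' assume B': "B' = (\<lambda>k. {#k, t' k#}) ` {2..s}"
    have tt: "t' k = t k" if "k \<in> {2..s}" for k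
    proof (rule pair_image_eq[OF _ that, of _ _ "{1, j}"])
      show "{#k, t' k#} \<in> (\<lambda>k. {#k, t k#}) ` {2..s}" using sub that unfolding B B' by blast
    qed (use t j in auto)
    then show "B' = B" unfolding B B' by (intro image_cong refl) (simp only: tt)
  qed
qed

lemma rels4a_minimal:
  assumes r: "(P, B) \<in> rels4a q s" and r': "(P, B') \<in> rels_all q s" and sub: "B' \<subseteq> B"
    and s: "3 \<le> s"
  shows "B' = B"
proof (rule rels4aE[OF r])
  fix j u t assume P: "P = {#1, j#}" and B: "B = (\<lambda>k. {#k, t k#}) ` {2..s} \<union> {{#u, j#}}"
    and ju: "s < j" "s < u" "j \<noteq> u" and t: "\<forall>k\<in>{2..s}. t k \<in> {1, k}"
  have sq: "{#1, 1#} \<notin> B" "{#j, j#} \<notin> B"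
    using ju s unfolding B by (auto simp: pair_in_image_iff pair_eq_iff)
  have kj: "{#k, j#} \<notin> B" if "k \<in> {2..s}" for k
  proof -
    have "t k \<in> {1, k}" using t that by blast
    then show ?thesis using ju s that unfolding B by (auto simp: pair_in_image_iff pair_eq_iff)
  qed
  have j': "j' = j" if "P = {#1, j'#}" for j' using that unfolding P by (auto simp: pair_eq_iff)
  have "(P, B') \<in> rels4a q s" using r'
  proof (cases rule: rels_all_cases)
    case rels12
    then show ?thesis unfolding P using rels12_at_one(2) sq sub by blast
  next
    case rels3a
    then show ?thesis by (rule rels3aE) (use j' ju s in force)
  next
    case rels3b
    then show ?thesis
    proof (rule rels3bE)
      fix j' t' assume "P = {#1, j'#}" and B': "B' = (\<lambda>k. {#k, t' k#}) ` {2..s}"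
        and "j' \<in> t' ` {2..s}"
      then obtain k where k: "k \<in> {2..s}" "t' k = j" using j' by blast
      then have "{#k, j#} \<in> B'" unfolding B' by blast
      then show ?thesis using kj[OF k(1)] sub by blast
    qed
  next
    case rels4b
    then show ?thesis by (rule rels4bE) (use j' sq(2) sub in blast)
  qed
  then show ?thesis
  proof (rule rels4aE)
    fix j2 u' t' assume "P = {#1, j2#}" and "B' = (\<lambda>k. {#k, t' k#}) ` {2..s} \<union> {{#u', j2#}}"
      and u': "s < u'"
    then have B': "B' = (\<lambda>k. {#k, t' k#}) ` {2..s} \<union> {{#u', j#}}" using j' by blast
    have tt: "t' k = t k" if k: "k \<in> {2..s}" for k
    proof (rule pair_image_eq[OF _ k, of _ _ "{1}"])
      \<comment> \<open>Both \<open>u\<close> and \<open>j\<close> exceed \<open>s\<close>, so the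
        extra pair of \<open>B\<close> cannot contain \<open>k\<close>. For the same reason the
        extra pairs of \<open>B'\<close> and \<open>B\<close> are matched with each other
        below.\<close>
      have "{#k, t' k#} \<noteq> {#u, j#}" using k ju by (auto simp: pair_eq_iff)
      then show "{#k, t' k#} \<in> (\<lambda>k. {#k, t k#}) ` {2..s}" using sub k unfolding B B' by blast
    qed (use t in auto)
    have "(\<lambda>k. {#k, t' k#}) ` {2..s} = (\<lambda>k. {#k, t k#}) ` {2..s}"
      by (intro image_cong refl) (simp only: tt)
    moreover have "{#u', j#} \<notin> (\<lambda>k. {#k, t k#}) ` {2..s}"
      using u' ju by (simp add: pair_in_image_iff)
    then have "{#u', j#} = {#u, j#}" using sub unfolding B B' by blast
    ultimately show "B' = B" unfolding B B' by (simp only:)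
  qed
qed

text \<open>No pair of \<open>B\<close> contains \<open>1\<close>, which excludes (1) and (2);
  \<open>1 < j\<close> excludes (3a); (4a) would need a pair with two different entries above
  \<open>s\<close>, whereas each pair of \<open>B\<close> is \<open>{#j, j#}\<close> or contains
  some \<open>k \<le> s\<close>.\<close>

lemma rels4b_extends_cases:
  assumes r: "(P, B) \<in> rels4b q s" and r': "(P, B') \<in> rels_all q s" and sub: "B' \<subseteq> B"
  shows "(P, B') \<in> rels3b q s \<union> rels4b q s"
proof (rule rels4bE[OF r])
  fix j t assume P: "P = {#1, j#}" and B: "B = (\<lambda>k. {#k, t k#}) ` {2..s} \<union> {{#j, j#}}"
    and j: "1 < j"
  have no_one: "{#1, b#} \<notin> B" for b using rels4b_one_notin[OF r] by force
  have j': "j' = j" if "P = {#1, j'#}" for j' using that unfolding P by (auto simp: pair_eq_iff)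
  show ?thesis using r'
  proof (cases rule: rels_all_cases)
    case rels12
    then show ?thesis unfolding P using rels12_at_one(2) no_one sub by blast
  next
    case rels3a
    then show ?thesis by (rule rels3aE) (use j' j in force)
  next
    case rels4a
    then show ?thesis
    proof (rule rels4aE)
      fix j2 u t' assume "P = {#1, j2#}" and B': "B' = (\<lambda>k. {#k, t' k#}) ` {2..s} \<union> {{#u, j2#}}"
        and u: "s < j2" "s < u" "j2 \<noteq> u"
      then have "{#u, j#} \<in> B" "s < j" "j \<noteq> u" using j' sub by blast+
      then show ?thesis using u unfolding B by (auto simp: pair_in_image_iff pair_eq_iff)
    qed
  qed blast+
qed

text \<open>The square \<open>{#j, j#}\<close> belongs to every right side of (4b), but for
  \<open>s < j\<close> it is no \<open>{#k, t k#}\<close>.\<close>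

lemma rels3b_rels4b_disjoint: "rels3b q s \<inter> rels4b q s = {}"
proof -
  have "(P, B) \<notin> rels4b q s" if r: "(P, B) \<in> rels3b q s" for P B
  proof
    assume r': "(P, B) \<in> rels4b q s"
    show False
    proof (rule rels3bE[OF r])
      fix j t assume P: "P = {#1, j#}" and B: "B = (\<lambda>k. {#k, t k#}) ` {2..s}" and j: "s < j"
      show False
      proof (rule rels4bE[OF r'])
        fix j' t' assume "P = {#1, j'#}" and B': "B = (\<lambda>k. {#k, t' k#}) ` {2..s} \<union> {{#j', j'#}}"
        then have "j' = j" unfolding P by (auto simp: pair_eq_iff)
        then have "{#j, j#} \<in> B" unfolding B' by blast
        then show False using j unfolding B by (auto simp: pair_in_image_iff)
      qed
    qed
  qed
  then show ?thesis by auto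
qed

text \<open>Relations of types (1), (2), (3) and (4a) are not proper extensions of listed ones; a
  relation of type (4b) can extend only those of types (3b) and (4b).\<close>

lemma minimal_rels_all:
  assumes s: "3 \<le> s"
  shows "{r \<in> rels_all q s. \<forall>r' \<in> rels_all q s. r' \<noteq> r \<longrightarrow> \<not> extension_of r r'} =
    rels1 q \<union> rels2 q \<union> rels3a q s \<union> rels3b q s \<union> rels4a q s \<union>
      {r \<in> rels4b q s.
        \<not> (\<exists>r' \<in> rels4b q s. r' \<noteq> r \<and> extension_of r r') \<and>
        \<not> (\<exists>r' \<in> rels3b q s. extension_of r r')}" (is "?M = ?R \<union> ?R4")
proof -
  have "r \<in> ?M" if r: "r \<in> ?R" for r
  proof -
    obtain P B where PB: "r = (P, B)" by force
    have "B' = B" if "(P, B') \<in> rels_all q s" "B' \<subseteq> B" for B'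
      using r[unfolded PB] rels12_minimal[of P B q B']
        rels_all_not_subset_singleton[OF that(1) s]
        rels3a_minimal[OF _ that] rels3b_minimal[OF _ that] rels4a_minimal[OF _ that s] that
      by blast
    moreover have "r \<in> rels_all q s" using r by blast
    ultimately show ?thesis unfolding PB by (force simp: extension_of_def)
  qed
  then have R: "?R \<subseteq> ?M" by (rule subsetI)
  have "r \<in> ?M \<longleftrightarrow> r \<in> ?R4" if r: "r \<in> rels4b q s" for r
  proof -
    obtain P B where PB: "r = (P, B)" by force
    define L where "L = rels_all q s"
    have "r' \<in> rels3b q s \<union> rels4b q s" if "r' \<in> L" "extension_of r r'" for r'
      using rels4b_extends_cases[of P B q s "snd r'"] r that unfolding PB extension_of_def L_def
      by (cases r') simp
    moreover have "rels3b q s \<subseteq> L" "rels4b q s \<subseteq> L" unfolding L_def by blast+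
    ultimately have "(\<forall>r' \<in> L. r' \<noteq> r \<longrightarrow> \<not> extension_of r r') \<longleftrightarrow>
        (\<forall>r' \<in> rels3b q s \<union> rels4b q s. r' \<noteq> r \<longrightarrow> \<not> extension_of r r')" by (meson subsetD UnI1 UnI2 UnE)
    also have "\<dots> \<longleftrightarrow> \<not> (\<exists>r' \<in> rels4b q s. r' \<noteq> r \<and> extension_of r r') \<and>
        \<not> (\<exists>r' \<in> rels3b q s. r' \<noteq> r \<and> extension_of r r')" by (simp only: ball_Un) blast
    \<comment> \<open>Types (3b) and (4b) share no relation, so \<open>r' \<noteq> r\<close> is
      automatic.\<close>
    also have "(\<exists>r' \<in> rels3b q s. r' \<noteq> r \<and> extension_of r r') \<longleftrightarrow>
        (\<exists>r' \<in> rels3b q s. extension_of r r')"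
      by (rule bex_cong[OF refl]) (use r rels3b_rels4b_disjoint in auto)
    finally show ?thesis using r unfolding L_def by simp
  qed
  then have R4: "?M \<inter> rels4b q s = ?R4" by blast
  have "M = R \<union> R4" if "R \<subseteq> M" "M \<inter> C = R4" "M \<subseteq> R \<union> C" 
    for M R R4 C :: "(nat multiset \<times> nat multiset set) set"
    using that by blast
  from this[OF R R4 Collect_restrict] show ?thesis .
qed
section \<open>Monomial ideals\<close>

lemma poly_ring_simps [simp]:
  "mult (poly_ring V) p r = p * r" "add (poly_ring V) p r = p + r" "zero (poly_ring V) = 0"
  "one (poly_ring V) = 1"
  by (simp_all add: poly_ring_def)

lemma in_carrier_poly_ring:
  "p \<in> carrier (poly_ring V) \<longleftrightarrow> (\<forall>t \<in> Poly_Mapping.keys p. Poly_Mapping.keys t \<subseteq> V)"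
  by (simp add: poly_ring_def)

lemma ring_poly_ring: "ring (poly_ring V :: ('v, 'k::field) mpol ring)"
  using cring_poly_ring by (rule cring.axioms)

lemma a_inv_poly_ring:
  fixes p :: "('v, 'k::field) mpol"
  assumes "p \<in> carrier (poly_ring V)"
  shows "a_inv (poly_ring V) p = - p"
proof -
  interpret ring "poly_ring V :: ('v, 'k) mpol ring" by (rule ring_poly_ring)
  show ?thesis by (rule minus_equality) (use assms in \<open>simp_all add: in_carrier_poly_ring\<close>)
qed

lemma keys_subset_keys_add:
  fixes s r :: "'v \<Rightarrow>\<^sub>0 nat"
  shows "Poly_Mapping.keys r \<subseteq> Poly_Mapping.keys (s + r)"
  by (auto simp: in_keys_iff lookup_add)

lemma poly_mapping_sum_single:
  fixes p :: "'a \<Rightarrow>\<^sub>0 'b::comm_monoid_add"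
  shows "p = (\<Sum>t \<in> Poly_Mapping.keys p. Poly_Mapping.single t (Poly_Mapping.lookup p t))"
proof (rule poly_mapping_eqI)
  fix k
  have "(\<Sum>t \<in> Poly_Mapping.keys p. Poly_Mapping.lookup (Poly_Mapping.single t (Poly_Mapping.lookup p t)) k) =
      (\<Sum>t \<in> Poly_Mapping.keys p. if k = t then Poly_Mapping.lookup p t else 0)"
    by (intro sum.cong refl) (auto simp: lookup_single when_def)
  also have "\<dots> = Poly_Mapping.lookup p k" by (simp add: in_keys_iff)
  finally show "Poly_Mapping.lookup p k = Poly_Mapping.lookup
      (\<Sum>t \<in> Poly_Mapping.keys p. Poly_Mapping.single t (Poly_Mapping.lookup p t)) k"
    by (simp add: lookup_sum)
qed

text \<open>The monomial ideal with generator exponents \<open>S\<close>, described term by term, so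
  that membership becomes a condition on exponent vectors.\<close>

definition multiples :: "'v set \<Rightarrow> ('v \<Rightarrow>\<^sub>0 nat) set \<Rightarrow> ('v, 'k::field) mpol set" where
  "multiples V S = {p \<in> carrier (poly_ring V). \<forall>t \<in> Poly_Mapping.keys p. \<exists>s\<in>S. \<exists>r. t = s + r}"

lemma ideal_multiples: "ideal (multiples V S :: ('v, 'k::field) mpol set) (poly_ring V)"
proof (rule idealI)
  interpret ring "poly_ring V :: ('v, 'k) mpol ring" by (rule ring_poly_ring)
  show "ring (poly_ring V :: ('v, 'k) mpol ring)" by (rule ring_poly_ring)
  have mult: "x * a \<in> multiples V S"
    if a: "a \<in> multiples V S" and x: "x \<in> carrier (poly_ring V)" for a x :: "('v, 'k) mpol"
  proof -
    have "\<exists>s\<in>S. \<exists>r. t = s + r" if t: "t \<in> Poly_Mapping.keys (x * a)" for t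
    proof -
      obtain b c where bc: "t = b + c" "c \<in> Poly_Mapping.keys a" using t keys_mult[of x a] by blast
      then obtain s r where "s \<in> S" "c = s + r" using a unfolding multiples_def by blast
      then have "t = s + (b + r)" using bc by (simp add: ac_simps)
      then show ?thesis using \<open>s \<in> S\<close> by blast
    qed
    then show ?thesis using a x carrier_poly_ring_mult unfolding multiples_def by blast
  qed
  show "x \<otimes>\<^bsub>poly_ring V\<^esub> a \<in> multiples V S" "a \<otimes>\<^bsub>poly_ring V\<^esub> x \<in> multiples V S"
    if "a \<in> multiples V S" "x \<in> carrier (poly_ring V)" for a x :: "('v, 'k) mpol"
    using mult[OF that] by (simp_all add: mult.commute)
  show "subgroup (multiples V S) (add_monoid (poly_ring V :: ('v, 'k) mpol ring))"
  proof
    show "multiples V S \<subseteq> carrier (add_monoid (poly_ring V :: ('v, 'k) mpol ring))"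
      unfolding multiples_def by auto
    show "\<one>\<^bsub>add_monoid (poly_ring V :: ('v, 'k) mpol ring)\<^esub> \<in> multiples V S"
      by (simp add: multiples_def in_carrier_poly_ring)
  next
    fix p r :: "('v, 'k) mpol" assume pr: "p \<in> multiples V S" "r \<in> multiples V S"
    then have "p + r \<in> carrier (poly_ring V)"
      using a_closed[of p r] unfolding multiples_def by simp
    then show "p \<otimes>\<^bsub>add_monoid (poly_ring V)\<^esub> r \<in> multiples V S"
      using pr Poly_Mapping.keys_add[of p r] unfolding multiples_def by auto
  next
    fix p :: "('v, 'k) mpol" assume p: "p \<in> multiples V S"
    then have "- p \<in> multiples V S" unfolding multiples_def by (simp add: in_carrier_poly_ring)
    moreover have "p \<in> carrier (poly_ring V)" using p unfolding multiples_def by simp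
    ultimately show "inv\<^bsub>add_monoid (poly_ring V)\<^esub> p \<in> multiples V S"
      using a_inv_poly_ring[of p V] unfolding a_inv_def by simp
  qed
qed

lemma keys_mono_of [simp]: "Poly_Mapping.keys (mono_of s :: ('v, 'k::field) mpol) = {s}"
  by (simp add: mono_of_def)

lemma mono_of_in_carrier [simp]:
  "(mono_of s :: ('v, 'k::field) mpol) \<in> carrier (poly_ring V) \<longleftrightarrow> Poly_Mapping.keys s \<subseteq> V"
  by (simp add: in_carrier_poly_ring)

text \<open>A polynomial is the finite sum of its terms, and a term with exponent
  \<open>s + r\<close> is a multiple of the generator \<open>mono_of s\<close>.\<close>

lemma genideal_monomials:
  assumes S: "\<And>s. s \<in> S \<Longrightarrow> Poly_Mapping.keys s \<subseteq> V"
  shows "genideal (poly_ring V) (mono_of ` S) = (multiples V S :: ('v, 'k::field) mpol set)"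
proof
  interpret ring "poly_ring V :: ('v, 'k) mpol ring" by (rule ring_poly_ring)
  let ?J = "genideal (poly_ring V) (mono_of ` S) :: ('v, 'k) mpol set"
  have "(mono_of s :: ('v, 'k) mpol) \<in> multiples V S" if "s \<in> S" for s
  proof -
    have "\<exists>s'\<in>S. \<exists>r. s = s' + r" using that by (intro bexI[of _ s] exI[of _ 0]) simp_all
    then show ?thesis using S[OF that] unfolding multiples_def by simp
  qed
  then show "?J \<subseteq> multiples V S"
    by (intro genideal_minimal ideal_multiples) blast
  have carr: "mono_of ` S \<subseteq> carrier (poly_ring V :: ('v, 'k) mpol ring)" using S by auto
  interpret J: ideal ?J "poly_ring V" by (rule genideal_ideal[OF carr])
  show "multiples V S \<subseteq> ?J"
  proof
    fix p :: "('v, 'k) mpol" assume p: "p \<in> multiples V S"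
    have single: "Poly_Mapping.single t (Poly_Mapping.lookup p t) \<in> ?J"
      if t: "t \<in> Poly_Mapping.keys p" for t
    proof -
      obtain s r where sr: "s \<in> S" "t = s + r" using p t unfolding multiples_def by blast
      have "Poly_Mapping.keys t \<subseteq> V"
        using p t unfolding multiples_def by (simp add: in_carrier_poly_ring)
      \<comment> \<open>Exponents are natural numbers, so nothing cancels in \<open>s + r\<close>,
        and the cofactor stays in the ring over \<open>V\<close>.\<close>
      then have "Poly_Mapping.keys r \<subseteq> V" using subset_trans[OF keys_subset_keys_add[of r s]] sr(2) by simp
      then have "Poly_Mapping.single r (Poly_Mapping.lookup p t) \<in> carrier (poly_ring V)"
        by (simp add: in_carrier_poly_ring)
      moreover have "mono_of s \<in> ?J" using genideal_self[OF carr] sr(1) by blast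
      ultimately have "mono_of s * Poly_Mapping.single r (Poly_Mapping.lookup p t) \<in> ?J"
        using J.I_r_closed by force
      then show ?thesis using sr by (simp add: mono_of_def mult_single)
    qed
    have "(\<Sum>t\<in>T. Poly_Mapping.single t (Poly_Mapping.lookup p t)) \<in> ?J"
      if "finite T" "T \<subseteq> Poly_Mapping.keys p" for T
      using that
    proof (induction T)
      case empty
      show ?case using J.zero_closed by simp
    next
      case (insert t T)
      then show ?case using J.a_closed[OF single[of t]] by simp
    qed
    then show "p \<in> ?J" using poly_mapping_sum_single[of p] by (metis finite_keys order_refl)
  qed
qed

text \<open>\<open>ideal_prod\<close> is built inductively from products of members by addition, and
  each exponent in such a product is a sum of one exponent from each factor.\<close>

lemma ideal_prod_monomials:
  assumes S: "\<And>s. s \<in> S \<Longrightarrow> Poly_Mapping.keys s \<subseteq> V" and T: "\<And>t. t \<in> T \<Longrightarrow> Poly_Mapping.keys t \<subseteq> V"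
  shows "ideal_prod (poly_ring V) (genideal (poly_ring V) (mono_of ` S))
      (genideal (poly_ring V) (mono_of ` T)) =
    (genideal (poly_ring V) (mono_of ` {s + t |s t. s \<in> S \<and> t \<in> T}) :: ('v, 'k::field) mpol set)"
    (is "ideal_prod ?R ?I ?J = genideal _ (_ ` ?ST)")
proof
  interpret ring "poly_ring V :: ('v, 'k) mpol ring" by (rule ring_poly_ring)
  have ST: "Poly_Mapping.keys u \<subseteq> V" if "u \<in> ?ST" for u
    using that S T Poly_Mapping.keys_add by fastforce
  interpret K: ideal "multiples V ?ST" ?R by (rule ideal_multiples)
  show "ideal_prod ?R ?I ?J \<subseteq> genideal ?R (mono_of ` ?ST)"
  proof
    fix p assume "p \<in> ideal_prod ?R ?I ?J"
    then have "p \<in> multiples V ?ST"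
    proof induction
      case (prod i j)
      have ij: "i \<in> multiples V S" "j \<in> multiples V T"
        using prod genideal_monomials[of S V] genideal_monomials[of T V] S T by blast+
      have "\<exists>u\<in>?ST. \<exists>r. w = u + r" if w: "w \<in> Poly_Mapping.keys (i * j)" for w
      proof -
        obtain a b where ab: "w = a + b" "a \<in> Poly_Mapping.keys i" "b \<in> Poly_Mapping.keys j"
          using w keys_mult[of i j] by blast
        obtain s r where sr: "s \<in> S" "a = s + r" using ij(1) ab(2) unfolding multiples_def by blast
        obtain t r' where tr: "t \<in> T" "b = t + r'" using ij(2) ab(3) unfolding multiples_def by blast
        have "w = (s + t) + (r + r')" using ab sr tr by (simp add: ac_simps)
        then show ?thesis using sr(1) tr(1) by blast
      qed
      moreover have "i * j \<in> carrier ?R"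
        using ij carrier_poly_ring_mult unfolding multiples_def by blast
      ultimately show ?case unfolding multiples_def by simp
    next
      case (sum p r)
      then show ?case using K.a_closed by blast
    qed
    then show "p \<in> genideal ?R (mono_of ` ?ST)" using genideal_monomials[of ?ST V] ST by blast
  qed
  have carr: "mono_of ` S \<subseteq> carrier ?R" "mono_of ` T \<subseteq> carrier ?R" using S T by auto
  have "mono_of (s + t) \<in> ideal_prod ?R ?I ?J" if "s \<in> S" "t \<in> T" for s t
  proof -
    have "mono_of s \<in> ?I" "mono_of t \<in> ?J" using genideal_self carr that by blast+
    then have "mono_of s \<otimes>\<^bsub>?R\<^esub> mono_of t \<in> ideal_prod ?R ?I ?J" by (rule ideal_prod.prod)
    then show ?thesis by (simp add: mono_of_mult)
  qed
  then show "genideal ?R (mono_of ` ?ST) \<subseteq> ideal_prod ?R ?I ?J"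
    by (intro genideal_minimal ideal_prod_is_ideal genideal_ideal carr) blast
qed

section \<open>Minimal monomial generators\<close>

text \<open>A generator that is left out is lost: a monomial in a monomial ideal is divisible by one
  of the generators, and \<open>min\<close> excludes all others. Equal exponents are a special case
  of \<open>min\<close>, which gives injectivity.\<close>

lemma minimally_generatedI:
  fixes u :: "'i \<Rightarrow> ('v, 'k::field) mpol"
  assumes u: "\<And>i. i \<in> \<Lambda> \<Longrightarrow> u i = mono_of (y i)" and V: "\<And>i. i \<in> \<Lambda> \<Longrightarrow> Poly_Mapping.keys (y i) \<subseteq> V"
    and I: "I = genideal (poly_ring V) (u ` \<Lambda>)"
    and min: "\<And>i k. i \<in> \<Lambda> \<Longrightarrow> k \<in> \<Lambda> \<Longrightarrow>
      \<forall>v. Poly_Mapping.lookup (y k) v \<le> Poly_Mapping.lookup (y i) v \<Longrightarrow> k = i"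
  shows "minimally_generated V I \<Lambda> u"
  unfolding minimally_generated_def
proof (intro conjI allI impI)
  interpret ring "poly_ring V :: ('v, 'k) mpol ring" by (rule ring_poly_ring)
  show "inj_on u \<Lambda>" by (rule inj_onI) (use u min in auto)
  show "u ` \<Lambda> \<subseteq> monomials V" unfolding monomials_def using u V by blast
  show "I = genideal (poly_ring V) (u ` \<Lambda>)" by (rule I)
  fix G assume G: "G \<subset> u ` \<Lambda>"
  then obtain i where i: "i \<in> \<Lambda>" "u i \<notin> G" by blast
  define K where "K = {k \<in> \<Lambda>. u k \<in> G}"
  have "G = u ` K" using G unfolding K_def by auto
  also have "\<dots> = mono_of ` y ` K" using u unfolding K_def image_image by (intro image_cong) auto
  finally have G': "G = mono_of ` y ` K" .
  have "genideal (poly_ring V) G = multiples V (y ` K)"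
    unfolding G' by (rule genideal_monomials) (use V in \<open>auto simp: K_def\<close>)
  moreover have "u i \<notin> multiples V (y ` K)"
  proof
    assume "u i \<in> multiples V (y ` K)"
    then obtain k r where "k \<in> K" "y i = y k + r" unfolding multiples_def u[OF i(1)] by auto
    then have "k \<in> \<Lambda>" "u k \<in> G" "k = i"
      using min[of i k] i unfolding K_def by (auto simp: lookup_add)
    then show False using i by blast
  qed
  moreover have "u i \<in> I"
    unfolding I by (rule subsetD[OF genideal_self]) (use u V i in auto)
  ultimately show "I \<noteq> genideal (poly_ring V) G" by blast
qed

text \<open>A generator divisible by another one is redundant, since its multiples are multiples of
  the other; removing it would contradict minimality.\<close>

lemma minimally_generatedD:
  fixes u :: "'i \<Rightarrow> ('v, 'k::field) mpol"
  assumes mg: "minimally_generated V I \<Lambda> u"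
    and u: "\<And>i. i \<in> \<Lambda> \<Longrightarrow> u i = mono_of (y i)" and V: "\<And>i. i \<in> \<Lambda> \<Longrightarrow> Poly_Mapping.keys (y i) \<subseteq> V"
    and ik: "i \<in> \<Lambda>" "k \<in> \<Lambda>" "y i = y k + r"
  shows "k = i"
proof (rule ccontr)
  assume "k \<noteq> i"
  have inj: "inj_on u \<Lambda>" and I: "I = genideal (poly_ring V) (u ` \<Lambda>)"
    and min: "\<And>G. G \<subset> u ` \<Lambda> \<Longrightarrow> I \<noteq> genideal (poly_ring V) G"
    using mg unfolding minimally_generated_def by blast+
  have u_im: "u ` K = mono_of ` y ` K" if "K \<subseteq> \<Lambda>" for K
    unfolding image_image using u that by (intro image_cong) auto
  let ?K = "\<Lambda> - {i}"
  have "u i \<notin> u ` ?K" using inj ik(1) by (auto dest: inj_onD)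
  then have "u ` ?K \<subset> u ` \<Lambda>" using ik(1) by blast
  moreover have "genideal (poly_ring V) (u ` K) = multiples V (y ` K)" if "K \<subseteq> \<Lambda>" for K
    unfolding u_im[OF that] by (rule genideal_monomials) (use V that in auto)
  moreover have "multiples V (y ` \<Lambda>) = (multiples V (y ` ?K) :: ('v, 'k) mpol set)"
  proof -
    have "(\<exists>l\<in>\<Lambda>. \<exists>r. t = y l + r) \<longleftrightarrow> (\<exists>l\<in>?K. \<exists>r. t = y l + r)" for t
    proof
      assume "\<exists>l\<in>\<Lambda>. \<exists>r. t = y l + r"
      then obtain l r' where l: "l \<in> \<Lambda>" "t = y l + r'" by blast
      show "\<exists>l\<in>?K. \<exists>r. t = y l + r"
      proof (cases "l = i")
        case True
        then have "t = y k + (r + r')" using l ik by (simp add: add.assoc)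
        then show ?thesis using ik(2) \<open>k \<noteq> i\<close> by blast
      qed (use l in blast)
    qed blast
    then show ?thesis unfolding multiples_def by simp
  qed
  ultimately show False using min[of "u ` ?K"] I by simp
qed

text \<open>Square-freeness of \<open>I\<close> provides some square-free generators and has to be
  transferred to the minimal ones. Each \<open>u i\<close> is a multiple of a square-free
  \<open>mono_of s \<in> I\<close>, itself a multiple of some \<open>u k\<close>; minimality gives
  \<open>k = i\<close>, hence \<open>y i = s\<close>.\<close>

lemma minimal_generators_sqfree:
  fixes u :: "'i \<Rightarrow> ('v, 'k::field) mpol"
  assumes sq: "sqfree_monomial_ideal V I" and mg: "minimally_generated V I \<Lambda> u"
    and u: "\<And>i. i \<in> \<Lambda> \<Longrightarrow> u i = mono_of (y i)" and V: "\<And>i. i \<in> \<Lambda> \<Longrightarrow> Poly_Mapping.keys (y i) \<subseteq> V"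
    and i: "i \<in> \<Lambda>"
  shows "Poly_Mapping.lookup (y i) v \<le> 1"
proof -
  interpret ring "poly_ring V :: ('v, 'k) mpol ring" by (rule ring_poly_ring)
  obtain M where M: "M \<subseteq> sqfree_monomials V" "I = genideal (poly_ring V) M"
    using sq unfolding sqfree_monomial_ideal_def by blast
  define S where "S = {s. (mono_of s :: ('v, 'k) mpol) \<in> M}"
  have MS: "M = mono_of ` S" using M(1) unfolding S_def sqfree_monomials_def by auto
  have S: "Poly_Mapping.keys s \<subseteq> V" "Poly_Mapping.lookup s v \<le> 1" if "s \<in> S" for s v
  proof -
    have "(mono_of s :: ('v, 'k) mpol) \<in> sqfree_monomials V" using M(1) that unfolding S_def by blast
    then show "Poly_Mapping.keys s \<subseteq> V" "Poly_Mapping.lookup s v \<le> 1"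
      unfolding sqfree_monomials_def by auto
  qed
  have IS: "I = multiples V S" using genideal_monomials[of S V] S(1) M(2) MS by blast
  have u_im: "u ` \<Lambda> = mono_of ` y ` \<Lambda>" unfolding image_image using u by (intro image_cong) auto
  have I: "I = genideal (poly_ring V) (u ` \<Lambda>)" using mg unfolding minimally_generated_def by blast
  then have Iy: "I = multiples V (y ` \<Lambda>)"
    using genideal_monomials[of "y ` \<Lambda>" V] V u_im by auto
  have "u i \<in> I" unfolding I by (rule subsetD[OF genideal_self]) (use u V i in auto)
  then obtain s r where sr: "s \<in> S" "y i = s + r" unfolding IS multiples_def u[OF i] by auto
  have "mono_of s \<in> I"
    unfolding M(2) MS by (rule subsetD[OF genideal_self]) (use S(1) sr(1) in auto)
  then obtain k r' where k: "k \<in> \<Lambda>" "s = y k + r'" unfolding Iy multiples_def by auto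
  have yk: "y i = y k + (r' + r)" using sr(2) k(2) by (simp add: add.assoc)
  have "k = i" by (rule minimally_generatedD[OF mg _ _ i k(1) yk]) (use u V in simp_all)
  then have "y i + (r' + r) = y i + 0" using yk by simp
  then have "r' + r = 0" by (rule add_left_imp_eq)
  then have "Poly_Mapping.lookup r v = 0" for v
    by (metis lookup_add lookup_zero add_is_0)
  then have "Poly_Mapping.lookup (y i) v = Poly_Mapping.lookup s v" using sr(2) by (simp add: lookup_add)
  then show ?thesis using S(2) sr(1) by simp
qed

section \<open>Divisibility relations in terms of exponents\<close>

text \<open>Exponents of an lcm are pointwise maxima, and a number is at most a finite maximum iff
  it is at most one of the members.\<close>

lemma div_rels_iff:
  fixes u :: "'i \<Rightarrow> ('v, 'k::field) mpol"
  assumes "finite \<Lambda>" and u: "\<And>i. i \<in> \<Lambda> \<Longrightarrow> u i = mono_of (y i)"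
  shows "(b, B) \<in> div_rels \<Lambda> u \<longleftrightarrow> b \<in> \<Lambda> \<and> B \<noteq> {} \<and> B \<subseteq> \<Lambda> \<and>
    (\<forall>v. \<exists>c\<in>B. Poly_Mapping.lookup (y b) v \<le> Poly_Mapping.lookup (y c) v)"
proof (cases "b \<in> \<Lambda> \<and> B \<noteq> {} \<and> B \<subseteq> \<Lambda>")
  case True
  then have fin: "finite (y ` B)" "y ` B \<noteq> {}" using assms(1) finite_subset by auto
  have "u ` B = mono_of ` y ` B" unfolding image_image using u True by (intro image_cong) auto
  then obtain t where t: "mono_lcm (u ` B) = (mono_of t :: ('v, 'k) mpol)"
    "\<And>v. Poly_Mapping.lookup t v = (MAX s\<in>y ` B. Poly_Mapping.lookup s v)"
    using mono_lcm_image[OF fin, where ?'k = 'k] by metis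
  have "u b dvd mono_lcm (u ` B) \<longleftrightarrow>
      (\<forall>v. Poly_Mapping.lookup (y b) v \<le> (MAX s\<in>y ` B. Poly_Mapping.lookup s v))"
    using True by (simp add: u t mono_of_dvd_iff)
  also have "\<dots> \<longleftrightarrow> (\<forall>v. \<exists>c\<in>B. Poly_Mapping.lookup (y b) v \<le> Poly_Mapping.lookup (y c) v)"
    using fin by (simp add: Max_ge_iff)
  finally show ?thesis using True unfolding div_rels_def by simp
qed (auto simp: div_rels_def)

definition pair_exp :: "(nat \<Rightarrow> 'v \<Rightarrow>\<^sub>0 nat) \<Rightarrow> nat multiset \<Rightarrow> ('v \<Rightarrow>\<^sub>0 nat)" where
  "pair_exp x P = (\<Sum>i\<in>#P. x i)"

lemma pair_exp_pair [simp]: "pair_exp x {#i, j#} = x i + x j"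
  by (simp add: pair_exp_def)

lemma pair_prod_eq_mono_of:
  fixes m :: "nat \<Rightarrow> ('v, 'k::field) mpol"
  assumes m: "\<And>i. i \<in> {1..q} \<Longrightarrow> m i = mono_of (x i)" and "P \<in> pairs q"
  shows "pair_prod m P = mono_of (pair_exp x P)"
proof -
  obtain i j where "P = {#i, j#}" "i \<in> {1..q}" "j \<in> {1..q}" using assms(2) by (rule in_pairsE)
  then show ?thesis by (simp add: pair_prod_def m mono_of_mult)
qed

text \<open>Exponents that are at most one are indicators, so adding them counts the entries of
  \<open>P\<close> whose generator \<open>v\<close> divides.\<close>

lemma lookup_pair_exp:
  assumes x: "\<And>i. i \<in> {1..q} \<Longrightarrow> Poly_Mapping.lookup (x i) v \<le> 1" and "P \<in> pairs q"
  shows "Poly_Mapping.lookup (pair_exp x P) v =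
    pair_deg {i \<in> {1..q}. Poly_Mapping.lookup (x i) v \<noteq> 0} P"
proof -
  have 1: "Poly_Mapping.lookup (x i) v = of_bool (Poly_Mapping.lookup (x i) v \<noteq> 0)"
    if "i \<in> {1..q}" for i
    using x[OF that] by (auto simp: of_bool_def)
  obtain i j where P: "P = {#i, j#}" "i \<in> {1..q}" "j \<in> {1..q}" using assms(2) by (rule in_pairsE)
  show ?thesis using 1[OF P(2)] 1[OF P(3)] P by (simp add: lookup_add)
qed

text \<open>The passage from polynomials to families of sets: each variable \<open>v\<close>
  contributes the indices of the generators it divides, possibly none.\<close>

lemma div_rels_pair_prod:
  fixes m :: "nat \<Rightarrow> ('v, 'k::field) mpol"
  assumes m: "\<And>i. i \<in> {1..q} \<Longrightarrow> m i = mono_of (x i)"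
    and x: "\<And>i v. i \<in> {1..q} \<Longrightarrow> Poly_Mapping.lookup (x i) v \<le> 1"
  shows "div_rels (pairs q) (pair_prod m) =
    cover_rels q (range (\<lambda>v. {i \<in> {1..q}. Poly_Mapping.lookup (x i) v \<noteq> 0}))"
proof -
  let ?A = "\<lambda>v. {i \<in> {1..q}. Poly_Mapping.lookup (x i) v \<noteq> 0}"
  have deg: "Poly_Mapping.lookup (pair_exp x P) v = pair_deg (?A v) P" if "P \<in> pairs q" for P v
    by (rule lookup_pair_exp) (use x that in simp_all)
  have "(P, B) \<in> div_rels (pairs q) (pair_prod m) \<longleftrightarrow> (P, B) \<in> cover_rels q (range ?A)" for P B
  proof -
    have "(P, B) \<in> div_rels (pairs q) (pair_prod m) \<longleftrightarrow> P \<in> pairs q \<and> B \<noteq> {} \<and> B \<subseteq> pairs q \<and>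
        (\<forall>v. \<exists>R\<in>B. Poly_Mapping.lookup (pair_exp x P) v \<le> Poly_Mapping.lookup (pair_exp x R) v)"
      by (rule div_rels_iff) (use pair_prod_eq_mono_of[of q m x] m in simp_all)
    also have "\<dots> \<longleftrightarrow> P \<in> pairs q \<and> B \<noteq> {} \<and> B \<subseteq> pairs q \<and>
        (\<forall>v. \<exists>R\<in>B. pair_deg (?A v) P \<le> pair_deg (?A v) R)"
      using deg by (intro conj_cong refl all_cong1 bex_cong) (simp add: subset_iff)
    finally show ?thesis unfolding cover_rels_def by (simp only: mem_Collect_eq case_prod_conv ball_simps)
  qed
  then show ?thesis by auto
qed

lemma ideal_square_monomials:
  fixes m :: "nat \<Rightarrow> ('v, 'k::field) mpol"
  assumes m: "\<And>i. i \<in> {1..q} \<Longrightarrow> m i = mono_of (x i)"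
    and V: "\<And>i. i \<in> {1..q} \<Longrightarrow> Poly_Mapping.keys (x i) \<subseteq> V"
    and I: "I = genideal (poly_ring V) (m ` {1..q})"
  shows "ideal_prod (poly_ring V) I I = genideal (poly_ring V) (pair_prod m ` pairs q)"
proof -
  have "m ` {1..q} = mono_of ` x ` {1..q}" unfolding image_image using m by (intro image_cong) auto
  then have Ix: "I = genideal (poly_ring V) (mono_of ` x ` {1..q})" using I by simp
  have "ideal_prod (poly_ring V) I I =
      genideal (poly_ring V) (mono_of ` {s + t |s t. s \<in> x ` {1..q} \<and> t \<in> x ` {1..q}})"
    unfolding Ix by (rule ideal_prod_monomials) (use V in blast)+
  also have "{s + t |s t. s \<in> x ` {1..q} \<and> t \<in> x ` {1..q}} = pair_exp x ` pairs q"
  proof (intro equalityI subsetI)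
    fix u assume "u \<in> {s + t |s t. s \<in> x ` {1..q} \<and> t \<in> x ` {1..q}}"
    then obtain i j where "i \<in> {1..q}" "j \<in> {1..q}" "u = x i + x j" by blast
    then have "{#i, j#} \<in> pairs q" "u = pair_exp x {#i, j#}" by simp_all
    then show "u \<in> pair_exp x ` pairs q" by blast
  next
    fix u assume "u \<in> pair_exp x ` pairs q"
    then obtain P where P: "P \<in> pairs q" "u = pair_exp x P" by blast
    from P(1) obtain i j where "P = {#i, j#}" "i \<in> {1..q}" "j \<in> {1..q}" by (rule in_pairsE)
    moreover from this have "u = x i + x j" using P(2) by simp
    ultimately show "u \<in> {s + t |s t. s \<in> x ` {1..q} \<and> t \<in> x ` {1..q}}" by blast
  qed
  also have "mono_of ` pair_exp x ` pairs q = pair_prod m ` pairs q"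
    unfolding image_image using pair_prod_eq_mono_of[OF m] by (intro image_cong) auto
  finally show ?thesis .
qed

lemma sqfree_ideal_square_relations:
  fixes m :: "nat \<Rightarrow> ('v, 'k::field) mpol"
  assumes sq: "sqfree_monomial_ideal V I" and mg: "minimally_generated V I {1..q} m"
  shows "ideal_prod (poly_ring V) I I = genideal (poly_ring V) (pair_prod m ` pairs q)"
    and "rels1 q \<union> rels2 q \<subseteq> div_rels (pairs q) (pair_prod m)"
    and "3 \<le> s \<Longrightarrow> s \<le> q \<Longrightarrow> (1, {2..s}) \<in> div_rels {1..q} m \<Longrightarrow>
      rels3a q s \<union> rels3b q s \<union> rels4a q s \<union> rels4b q s \<subseteq> div_rels (pairs q) (pair_prod m)"
proof -
  have "\<exists>t. m i = mono_of t \<and> Poly_Mapping.keys t \<subseteq> V" if "i \<in> {1..q}" for i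
    using mg that unfolding minimally_generated_def monomials_def by blast
  then obtain x where m: "\<And>i. i \<in> {1..q} \<Longrightarrow> m i = mono_of (x i)"
    and V: "\<And>i. i \<in> {1..q} \<Longrightarrow> Poly_Mapping.keys (x i) \<subseteq> V" by metis
  have I: "I = genideal (poly_ring V) (m ` {1..q})"
    using mg unfolding minimally_generated_def by blast
  show "ideal_prod (poly_ring V) I I = genideal (poly_ring V) (pair_prod m ` pairs q)"
    by (rule ideal_square_monomials[OF m V I])
  have x: "Poly_Mapping.lookup (x i) v \<le> 1" if "i \<in> {1..q}" for i v
    by (rule minimal_generators_sqfree[OF sq mg m V that])
  let ?F = "range (\<lambda>v. {i \<in> {1..q}. Poly_Mapping.lookup (x i) v \<noteq> 0})"
  have div: "div_rels (pairs q) (pair_prod m) = cover_rels q ?F" by (rule div_rels_pair_prod[OF m x])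
  show "rels1 q \<union> rels2 q \<subseteq> div_rels (pairs q) (pair_prod m)"
    unfolding div by (rule rels12_subset_cover_rels)
  assume s: "3 \<le> s" "s \<le> q" and rel: "(1, {2..s}) \<in> div_rels {1..q} m"
  \<comment> \<open>Reading the given relation at the variable \<open>v\<close> that defines
    \<open>A\<close>: if \<open>v\<close> divides \<open>m 1\<close>, it divides some
    \<open>m k\<close> with \<open>k \<in> {2..s}\<close>.\<close>
  have "\<exists>k\<in>{2..s}. k \<in> A" if A: "A \<in> ?F" "1 \<in> A" for A
  proof -
    obtain v where v: "A = {i \<in> {1..q}. Poly_Mapping.lookup (x i) v \<noteq> 0}" using A(1) by blast
    have "(1, {2..s}) \<in> div_rels {1..q} m \<longleftrightarrow> 1 \<in> {1..q} \<and> {2..s} \<noteq> {} \<and> {2..s} \<subseteq> {1..q} \<and>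
        (\<forall>v. \<exists>k\<in>{2..s}. Poly_Mapping.lookup (x 1) v \<le> Poly_Mapping.lookup (x k) v)"
      by (rule div_rels_iff) (use m in simp_all)
    then obtain k where k: "k \<in> {2..s}"
        "Poly_Mapping.lookup (x 1) v \<le> Poly_Mapping.lookup (x k) v"
      using rel by blast
    then show ?thesis using A(2) s unfolding v by (intro bexI[OF _ k(1)]) auto
  qed
  then show "rels3a q s \<union> rels3b q s \<union> rels4a q s \<union> rels4b q s \<subseteq> div_rels (pairs q) (pair_prod m)"
    unfolding div using rels3_subset_cover_rels[OF s, of ?F] rels4_subset_cover_rels[OF s, of ?F]
    by blast
qed

section \<open>Extremal ideals\<close>

definition ext_exp :: "nat \<Rightarrow> (nat \<times> nat set) set \<Rightarrow> nat \<Rightarrow> (nat set \<Rightarrow>\<^sub>0 nat)" where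
  "ext_exp q D i = (\<Sum>A \<in> {A \<in> ext_Q q D. i \<in> A}. Poly_Mapping.single A 1)"

lemma finite_ext_Q: "finite (ext_Q q D)"
  by (rule finite_subset[of _ "Pow {1..q}"]) (auto simp: ext_Q_def)

lemma lookup_ext_exp:
  "Poly_Mapping.lookup (ext_exp q D i) A = of_bool (A \<in> ext_Q q D \<and> i \<in> A)"
proof -
  have "Poly_Mapping.lookup (ext_exp q D i) A = (\<Sum>C \<in> {C \<in> ext_Q q D. i \<in> C}. if A = C then 1 else 0)"
    unfolding ext_exp_def lookup_sum
    by (intro sum.cong refl) (auto simp: lookup_single when_def)
  also have "\<dots> = of_bool (A \<in> ext_Q q D \<and> i \<in> A)" using finite_ext_Q by simp
  finally show ?thesis .
qed

lemma ext_gen_eq_mono_of: "ext_gen q D i = (mono_of (ext_exp q D i) :: (nat set, 'k::field) mpol)"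
proof -
  have "(\<Prod>A\<in>K. var A) = (mono_of (\<Sum>A\<in>K. Poly_Mapping.single A 1) :: (nat set, 'k) mpol)"
    if "finite K" for K
    using that
  proof (induction K)
    case empty
    show ?case by (simp add: mono_of_def)
  next
    case (insert A K)
    then show ?case by (simp add: var_def mono_of_mult)
  qed
  then show ?thesis unfolding ext_gen_def ext_exp_def using finite_ext_Q by simp
qed

lemma keys_ext_exp: "Poly_Mapping.keys (ext_exp q D i) \<subseteq> ext_vars q"
proof -
  have "ext_Q q D \<subseteq> ext_vars q" unfolding ext_Q_def ext_vars_def by blast
  then show ?thesis by (auto simp: in_keys_iff lookup_ext_exp)
qed

text \<open>The variable indexed by \<open>A\<close> divides \<open>ext_gen q D i\<close> exactly
  when \<open>A \<in> ext_Q q D\<close> and \<open>i \<in> A\<close>. So an allowed \<open>A\<close>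
  contributes itself, and every other variable contributes the empty set.\<close>

lemma div_rels_ext:
  "div_rels (pairs q) (pair_prod (ext_gen q D :: nat \<Rightarrow> (nat set, 'k::field) mpol)) =
    cover_rels q (ext_Q q D)"
proof -
  let ?F = "range (\<lambda>A. {i \<in> {1..q}. Poly_Mapping.lookup (ext_exp q D i) A \<noteq> 0})"
  have A: "{i \<in> {1..q}. Poly_Mapping.lookup (ext_exp q D i) A \<noteq> 0} =
      (if A \<in> ext_Q q D then A else {})" for A
    by (auto simp: lookup_ext_exp ext_Q_def)
  have sub: "ext_Q q D \<subseteq> ?F" "?F \<subseteq> insert {} (ext_Q q D)" unfolding A by auto
  \<comment> \<open>On the empty set all degrees are zero, so it imposes nothing on a nonempty
    \<open>B\<close>.\<close>
  have ins: "cover_rels q (insert {} (ext_Q q D)) = cover_rels q (ext_Q q D)"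
    unfolding cover_rels_def by (auto simp: pair_deg_def)
  have mono: "cover_rels q G \<subseteq> cover_rels q F" if "F \<subseteq> G" for F G
    using that unfolding cover_rels_def by blast
  have "cover_rels q ?F = cover_rels q (ext_Q q D)"
    using mono[OF sub(1)] mono[OF sub(2)] unfolding ins by (rule subset_antisym)
  moreover have "div_rels (pairs q) (pair_prod (ext_gen q D :: nat \<Rightarrow> (nat set, 'k::field) mpol)) =
      cover_rels q ?F"
    by (rule div_rels_pair_prod) (simp_all add: ext_gen_eq_mono_of lookup_ext_exp)
  ultimately show ?thesis by simp
qed

section \<open>Squares of extremal ideals\<close>

text \<open>The scheme common to both choices of \<open>D\<close>, with \<open>L\<close> the list of
  relations. By \<open>ext\<close> the minimal relations are the minimal members of
  \<open>L\<close>; \<open>ext\<close> and \<open>single\<close> together exclude divisibility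
  between distinct products, so these generate the square minimally.\<close>

lemma ext_square:
  fixes L :: "(nat multiset \<times> nat multiset set) set"
  assumes L: "L \<subseteq> cover_rels q (ext_Q q D)" "\<And>r. r \<in> L \<Longrightarrow> \<not> trivial_rel r"
    and single: "\<And>P B R. (P, B) \<in> L \<Longrightarrow> \<not> B \<subseteq> {R}"
    and ext: "\<And>P B. (P, B) \<in> cover_rels q (ext_Q q D) \<Longrightarrow> P \<notin> B \<Longrightarrow> \<exists>r\<in>L. extension_of (P, B) r"
  shows "minimally_generated (ext_vars q)
      (ideal_prod (poly_ring (ext_vars q)) (ext_ideal q D) (ext_ideal q D)) (pairs q)
      (pair_prod (ext_gen q D :: nat \<Rightarrow> (nat set, 'k::field) mpol))"
    and "min_div_rels (pairs q) (pair_prod (ext_gen q D :: nat \<Rightarrow> (nat set, 'k::field) mpol)) =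
      {r \<in> L. \<forall>r'\<in>L. r' \<noteq> r \<longrightarrow> \<not> extension_of r r'}"
proof -
  let ?e = "ext_gen q D :: nat \<Rightarrow> (nat set, 'k) mpol"
  let ?x = "ext_exp q D"
  have e: "pair_prod ?e P = mono_of (pair_exp ?x P)" if "P \<in> pairs q" for P
    by (rule pair_prod_eq_mono_of[OF _ that]) (rule ext_gen_eq_mono_of)
  show "minimally_generated (ext_vars q)
      (ideal_prod (poly_ring (ext_vars q)) (ext_ideal q D) (ext_ideal q D)) (pairs q) (pair_prod ?e)"
  proof (rule minimally_generatedI[OF e])
    show "Poly_Mapping.keys (pair_exp ?x P) \<subseteq> ext_vars q" if P: "P \<in> pairs q" for P
    proof -
      obtain i j where "P = {#i, j#}" using P by (rule in_pairsE)
      then show ?thesis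
        using Poly_Mapping.keys_add[of "?x i" "?x j"] keys_ext_exp[of q D i] keys_ext_exp[of q D j]
        by auto
    qed
    show "ideal_prod (poly_ring (ext_vars q)) (ext_ideal q D) (ext_ideal q D) =
        genideal (poly_ring (ext_vars q)) (pair_prod ?e ` pairs q)"
      by (rule ideal_square_monomials[OF ext_gen_eq_mono_of keys_ext_exp ext_ideal_def])
    show "R = P" if "P \<in> pairs q" "R \<in> pairs q"
      "\<forall>v. Poly_Mapping.lookup (pair_exp ?x R) v \<le> Poly_Mapping.lookup (pair_exp ?x P) v" for P R
    proof (rule ccontr)
      assume "R \<noteq> P"
      \<comment> \<open>Divisibility of one product by a different one is a nontrivial relation with
        a singleton on the right.\<close>
      have "(R, {P}) \<in> div_rels (pairs q) (pair_prod ?e)"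
        using that by (simp add: div_rels_iff[OF finite_pairs e])
      then obtain r where "r \<in> L" "extension_of (R, {P}) r"
        using ext[of R "{P}"] \<open>R \<noteq> P\<close> unfolding div_rels_ext by blast
      then show False using single[of "fst r" "snd r" P] unfolding extension_of_def by simp
    qed
  qed
  show "min_div_rels (pairs q) (pair_prod ?e) = {r \<in> L. \<forall>r'\<in>L. r' \<noteq> r \<longrightarrow> \<not> extension_of r r'}"
    by (rule min_div_rels_eqI)
      (use L ext in \<open>force simp: div_rels_ext trivial_rel_def\<close>)+
qed

text \<open>Right sides of (1) and (2) have exactly two elements, so one contains another only if
  they agree.\<close>

lemma minimal_rels12:
  "{r \<in> rels1 q \<union> rels2 q. \<forall>r' \<in> rels1 q \<union> rels2 q. r' \<noteq> r \<longrightarrow> \<not> extension_of r r'} =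
    rels1 q \<union> rels2 q"
proof -
  have "r' = r" if r: "r \<in> rels1 q \<union> rels2 q" "r' \<in> rels1 q \<union> rels2 q" "extension_of r r'" for r r'
  proof -
    obtain P B B' where "r = (P, B)" "r' = (P, B')" "B' \<subseteq> B"
      using r(3) unfolding extension_of_def by (metis prod.collapse)
    then show ?thesis
      using rels12_minimal[of P B q B'] rels12_not_subset_singleton[of P B' q] r by blast
  qed
  then show ?thesis by blast
qed

lemma rels_all_subset_cover_rels:
  assumes "3 \<le> s" "s \<le> q"
  shows "rels_all q s \<subseteq> cover_rels q (ext_Q q {(1, {2..s})})"
proof -
  let ?F = "ext_Q q {(1, {2..s})}"
  have "\<exists>k\<in>{2..s}. k \<in> A" if "A \<in> ?F" "1 \<in> A" for A
    using that unfolding ext_Q_single by blast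
  then show ?thesis
    using rels12_subset_cover_rels[of q ?F] rels3_subset_cover_rels[OF assms, of ?F]
      rels4_subset_cover_rels[OF assms, of ?F] by blast
qed

theorem theorem3p9:
  fixes q :: nat
  assumes "q > 0"
  shows
    "(\<forall>(V :: 'v set) (I :: ('v, 'k::field) mpol set) (m :: nat \<Rightarrow> ('v, 'k) mpol).
        finite V \<and> sqfree_monomial_ideal V I \<and> minimally_generated V I {1..q} m \<longrightarrow>
          ideal_prod (poly_ring V) I I = genideal (poly_ring V) (pair_prod m ` pairs q) \<and>
          rels1 q \<union> rels2 q \<subseteq> div_rels (pairs q) (pair_prod m) \<and>
          (\<forall>s. 3 \<le> s \<and> s \<le> q \<and> (1, {2..s}) \<in> div_rels {1..q} m \<longrightarrow>
             rels3a q s \<union> rels3b q s \<union> rels4a q s \<union> rels4b q s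
               \<subseteq> div_rels (pairs q) (pair_prod m))) \<and>
     (let E = (ext_ideal q {} :: (nat set, 'k) mpol set);
          e = (ext_gen q {} :: nat \<Rightarrow> (nat set, 'k) mpol);
          R = poly_ring (ext_vars q)
      in minimally_generated (ext_vars q) (ideal_prod R E E) (pairs q) (pair_prod e) \<and>
         min_div_rels (pairs q) (pair_prod e) = rels1 q \<union> rels2 q) \<and>
     (\<forall>s. 3 \<le> s \<and> s \<le> q \<longrightarrow>
        (let D = {(1, {2..s})};
             E = (ext_ideal q D :: (nat set, 'k) mpol set);
             e = (ext_gen q D :: nat \<Rightarrow> (nat set, 'k) mpol);
             R = poly_ring (ext_vars q)
         in minimally_generated (ext_vars q) (ideal_prod R E E) (pairs q) (pair_prod e) \<and>
            min_div_rels (pairs q) (pair_prod e) =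
              rels1 q \<union> rels2 q \<union> rels3a q s \<union> rels3b q s \<union> rels4a q s \<union>
              {r \<in> rels4b q s.
                 \<not> (\<exists>r' \<in> rels4b q s. r' \<noteq> r \<and> extension_of r r') \<and>
                 \<not> (\<exists>r' \<in> rels3b q s. extension_of r r')}))"
proof (intro conjI allI impI)
  fix V :: "'v set" and I :: "('v, 'k) mpol set" and m :: "nat \<Rightarrow> ('v, 'k) mpol"
  assume "finite V \<and> sqfree_monomial_ideal V I \<and> minimally_generated V I {1..q} m"
  then have "sqfree_monomial_ideal V I" "minimally_generated V I {1..q} m" by blast+
  note I = sqfree_ideal_square_relations[OF this]
  show "ideal_prod (poly_ring V) I I = genideal (poly_ring V) (pair_prod m ` pairs q)"
    by (rule I(1))
  show "rels1 q \<union> rels2 q \<subseteq> div_rels (pairs q) (pair_prod m)" by (rule I(2))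
  show "rels3a q s \<union> rels3b q s \<union> rels4a q s \<union> rels4b q s \<subseteq> div_rels (pairs q) (pair_prod m)"
    if "3 \<le> s \<and> s \<le> q \<and> (1, {2..s}) \<in> div_rels {1..q} m" for s
    using that I(3) by blast
next
  note E = ext_square[where L = "rels1 q \<union> rels2 q" and q = q and D = "{}"]
  show "let E = (ext_ideal q {} :: (nat set, 'k) mpol set);
          e = (ext_gen q {} :: nat \<Rightarrow> (nat set, 'k) mpol);
          R = poly_ring (ext_vars q)
      in minimally_generated (ext_vars q) (ideal_prod R E E) (pairs q) (pair_prod e) \<and>
         min_div_rels (pairs q) (pair_prod e) = rels1 q \<union> rels2 q"
    unfolding Let_def
    by (intro conjI E(1) E(2)[unfolded minimal_rels12] rels12_subset_cover_rels rels12_nontrivial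
        rels12_not_subset_singleton cover_rels_empty_extends)
next
  fix s assume s: "3 \<le> s \<and> s \<le> q"
  then have s': "3 \<le> s" "s \<le> q" by blast+
  note E = ext_square[where L = "rels_all q s" and q = q and D = "{(1, {2..s})}"]
  show "let D = {(1, {2..s})};
             E = (ext_ideal q D :: (nat set, 'k) mpol set);
             e = (ext_gen q D :: nat \<Rightarrow> (nat set, 'k) mpol);
             R = poly_ring (ext_vars q)
         in minimally_generated (ext_vars q) (ideal_prod R E E) (pairs q) (pair_prod e) \<and>
            min_div_rels (pairs q) (pair_prod e) =
              rels1 q \<union> rels2 q \<union> rels3a q s \<union> rels3b q s \<union> rels4a q s \<union>
              {r \<in> rels4b q s.
                 \<not> (\<exists>r' \<in> rels4b q s. r' \<noteq> r \<and> extension_of r r') \<and>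
                 \<not> (\<exists>r' \<in> rels3b q s. extension_of r r')}"
    unfolding Let_def
    by (intro conjI E(1) E(2)[unfolded minimal_rels_all[OF s'(1)]]
        rels_all_subset_cover_rels s' rels_all_nontrivial[OF _ s'(1)]
        rels_all_not_subset_singleton[OF _ s'(1)]
        cover_rels_single_extends)
qed

end
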